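(* Let $n$ and $p$ be positive integers with $n>2p$, and let $k=n-2p$. For an integer $z$ with $0\le z\le \frac{n-k}{2}$, let $b(z)$ denote the remainder of $\frac{n-k}{2}-z$ upon division by $k+z$ (so $0\le b(z)\le k+z-1$), and define \[ D(z)= -z^2+(2n+1)z+\frac{(n+k)^2}{k+z}-3n-k+4\Big(b(z)-\frac{b(z)^2}{k+z}\Big). \] Let $z^\dagger=\frac{1}{4}\big(\sqrt{8n+8k+1}-4k+1\big)$. Then \[ \mathrm{sat}(n,(p+1)K_2)=\begin{cases}\displaystyle\min_{z\in\{\lfloor z^\dagger\rfloor,\lceil z^\dagger\rceil\}}\frac{D(z)}{2} & \text{if } n>2k^2-2k,\\[6pt] \dfrac{D(0)}{2} & \text{if } n\le 2k^2-2k.\end{cases} \]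
   Context: All graphs are finite, simple and undirected. $(p+1)K_2$ denotes a matching with $p+1$ edges. A graph $G$ is $(p+1)K_2$-saturated if $G$ contains no matching of size $p+1$, but for every pair of nonadjacent vertices $u,v$ of $G$, the graph $G+uv$ contains a matching of size $p+1$. $\mathrm{sat}(n,(p+1)K_2)$ denotes the minimum number of edges in a $(p+1)K_2$-saturated graph on $n$ vertices.
   Formalization: The formal theorem assumes n ≥ 2p+2, excluding n = 2p+1 (k = 1), where the claim is false: for n = 3, p = 1 only K_3 is saturated, so sat = 3, but D(1)/2 = 2; the formula fails in the same way for every p when k = 1. *)

theory Defs
  imports Complex_Main
begin

text \<open>A finite simple undirected graph is given by its vertex set and its set of edges,
  an edge being a two-element set of vertices.\<close>

definition simple_graph :: "'a set \<Rightarrow> 'a set set \<Rightarrow> bool" where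
  "simple_graph V E \<longleftrightarrow> finite V \<and> (\<forall>e\<in>E. e \<subseteq> V \<and> card e = 2)"

definition has_matching :: "'a set set \<Rightarrow> nat \<Rightarrow> bool" where
  "has_matching E m \<longleftrightarrow> (\<exists>M\<subseteq>E. finite M \<and> card M = m \<and> pairwise disjnt M)"

definition matching_saturated :: "nat \<Rightarrow> 'a set \<Rightarrow> 'a set set \<Rightarrow> bool" where
  "matching_saturated m V E \<longleftrightarrow>
     \<not> has_matching E m \<and>
     (\<forall>u\<in>V. \<forall>v\<in>V. u \<noteq> v \<and> {u, v} \<notin> E \<longrightarrow> has_matching (insert {u, v} E) m)"

text \<open>The saturation number of \<open>m K\<^sub>2\<close>. Every graph on \<open>n\<close> vertices is isomorphic to one with
  vertices in \<^typ>\<open>nat\<close>. For \<open>m \<ge> 1\<close> a saturated graph exists (add edges for as long as no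
  matching of size \<open>m\<close> arises), so the \<open>LEAST\<close> is attained.
  For \<open>n < 2 * m\<close> the notion degenerates: the complete graph is the only saturated graph.\<close>

definition sat_matching :: "nat \<Rightarrow> nat \<Rightarrow> nat" where
  "sat_matching n m =
     (LEAST e. \<exists>(V :: nat set) E.
        simple_graph V E \<and> card V = n \<and> matching_saturated m V E \<and> card E = e)"

text \<open>In the following, \<open>n - k\<close> is even and \<open>k \<ge> 1\<close>, so the integer division by 2 is exact and
  the modulus \<open>k + z\<close> is positive for \<open>z \<ge> 0\<close>.\<close>

definition b_rem :: "nat \<Rightarrow> nat \<Rightarrow> int \<Rightarrow> int" where
  "b_rem n k z = ((int n - int k) div 2 - z) mod (int k + z)"

definition D :: "nat \<Rightarrow> nat \<Rightarrow> int \<Rightarrow> real" where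
  "D n k z =
     - (real_of_int z)\<^sup>2 + (2 * real n + 1) * real_of_int z
     + (real n + real k)\<^sup>2 / (real k + real_of_int z) - 3 * real n - real k
     + 4 * (real_of_int (b_rem n k z)
            - (real_of_int (b_rem n k z))\<^sup>2 / (real k + real_of_int z))"

definition z_dagger :: "nat \<Rightarrow> nat \<Rightarrow> real" where
  "z_dagger n k = (1 / 4) * (sqrt (8 * real n + 8 * real k + 1) - 4 * real k + 1)"

text \<open>The formula built from these functions holds only for \<open>n \<ge> 2 * (p + 1)\<close>, the order of
  \<open>(p + 1) K\<^sub>2\<close>. It fails for \<open>n = 2 * p + 1\<close>, i.e. \<open>k = 1\<close>: for \<open>n = 3\<close> and \<open>p = 1\<close> the
  saturation number is 3, attained by the complete graph only, while \<open>D 3 1 1 / 2 = 2\<close>.\<close>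

end

theory Submission
  imports Defs "HOL-Library.Disjoint_Sets"
begin

text \<open>Let \<open>G\<close> be \<open>(p + 1) K\<^sub>2\<close>-saturated on \<open>n = 2 p + k\<close> vertices, \<open>k \<ge> 2\<close>. Two vertices are
  nonadjacent iff some maximum matching misses both, so by Gallai's lemma adjacency is transitive
  outside the set \<open>U\<close> of universal vertices: \<open>G - U\<close> is a disjoint union of cliques. Every vertex of
  such a clique is missed by a maximum matching that matches the rest of the clique within itself,
  so the cliques are odd. For a fixed maximum matching each clique contains either exactly one of
  the \<open>k\<close> missed vertices or exactly one partner of a vertex of \<open>U\<close>, so there are \<open>k + z\<close> cliques, where
  \<open>z = |U|\<close>. Conversely all such joins are saturated.

  If the cliques have \<open>2 c\<^sub>i - 1\<close> vertices, then \<open>\<Sum> c\<^sub>i = p + k\<close>, and the number of edges is least when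
  \<open>\<Sum> c\<^sub>i\<^sup>2\<close> is; this minimum over balanced sizes is \<open>D z / 2\<close>. With \<open>s = k + z\<close> and \<open>N = p + k\<close>,
  it is nonincreasing in \<open>z\<close> while \<open>2 s\<^sup>2 - s \<le> 2 N\<close> and nondecreasing from \<open>2 s\<^sup>2 - s \<ge> 2 N\<close> on,
  and \<open>z\<^sup>\<dagger>\<close> is the root of \<open>2 s\<^sup>2 - s = 2 N\<close>.\<close>

section \<open>Matchings\<close>

definition matching :: "'a set set \<Rightarrow> bool" where
  "matching M \<longleftrightarrow> finite M \<and> pairwise disjnt M \<and> (\<forall>e\<in>M. card e = 2)"

lemma matching_insert:
  assumes "matching M" "x \<noteq> y" "x \<notin> \<Union>M" "y \<notin> \<Union>M"
  shows "matching (insert {x, y} M)" "card (insert {x, y} M) = Suc (card M)"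
proof -
  show "matching (insert {x, y} M)"
    using assms by (auto simp: matching_def pairwise_insert disjnt_def)
  have "{x, y} \<notin> M"
    using assms by auto
  then show "card (insert {x, y} M) = Suc (card M)"
    using assms by (auto simp: matching_def)
qed

lemma matching_subset: "matching M \<Longrightarrow> N \<subseteq> M \<Longrightarrow> matching N"
  by (auto simp: matching_def intro: finite_subset pairwise_subset)

lemma Union_matching_remove:
  assumes "matching M" "e \<in> M"
  shows "\<Union>(M - {e}) = \<Union>M - e"
  using assms by (auto simp: matching_def pairwise_def disjnt_def)

lemma matching_partner:
  assumes "matching M" "x \<in> \<Union>M"
  obtains y where "y \<noteq> x" "{x, y} \<in> M"
proof -
  obtain e where e: "e \<in> M" "x \<in> e"
    using assms by auto
  then have "card e = 2"
    using assms by (auto simp: matching_def)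
  with e obtain y where "e = {x, y}" "y \<noteq> x"
    by (auto simp: card_2_iff)
  with e that show thesis
    by auto
qed

lemma matching_partner_unique:
  assumes "matching M" "{x, y} \<in> M" "{x, y'} \<in> M"
  shows "y = y'"
proof (rule ccontr)
  assume "y \<noteq> y'"
  then have "{x, y} \<noteq> {x, y'}"
    by (auto simp: doubleton_eq_iff)
  then have "disjnt {x, y} {x, y'}"
    using assms pairwiseD[of disjnt M] unfolding matching_def by blast
  then show False
    by (auto simp: disjnt_def)
qed

lemma card_Union_matching:
  assumes "matching M"
  shows "card (\<Union>M) = 2 * card M"
proof -
  have "card (\<Union>M) = (\<Sum>e\<in>M. card e)"
    using assms by (intro card_Union_disjoint) (auto simp: matching_def intro: card_ge_0_finite)
  also have "\<dots> = 2 * card M"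
    using assms by (simp add: matching_def)
  finally show ?thesis .
qed

lemma has_matching_iff:
  assumes "\<forall>e\<in>E. card e = 2"
  shows "has_matching E m \<longleftrightarrow> (\<exists>M\<subseteq>E. matching M \<and> card M = m)"
  using assms unfolding has_matching_def matching_def by (metis subsetD)

text \<open>Follows the alternating path from \<open>b\<close> in \<open>M1 \<union> M2\<close>: it either augments \<open>M2\<close>, or
  exchanges \<open>b\<close> for another vertex in \<open>M1\<close>.\<close>

lemma matching_exchange:
  assumes "matching M1" "matching M2" "b \<in> \<Union>M1" "b \<notin> \<Union>M2"
  shows "(\<exists>M w. M \<subseteq> M1 \<union> M2 \<and> matching M \<and> card M = Suc (card M2)
             \<and> w \<notin> \<Union>M2 \<and> w \<noteq> b \<and> \<Union>M = \<Union>M2 \<union> {b, w})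
       \<or> (\<exists>M w. M \<subseteq> M1 \<union> M2 \<and> matching M \<and> card M = card M1
             \<and> w \<notin> \<Union>M1 \<and> \<Union>M = insert w (\<Union>M1 - {b}))"
  using assms
proof (induction "card M1" arbitrary: M1 M2 b rule: less_induct)
  case less
  note m1 = less.prems(1) and m2 = less.prems(2) and b2 = less.prems(4)
  have fin: "finite M1" "finite M2"
    using m1 m2 by (auto simp: matching_def)
  obtain x where x: "x \<noteq> b" "{b, x} \<in> M1"
    using matching_partner[OF m1 less.prems(3)] by blast
  let ?N1 = "M1 - {{b, x}}"
  have n1: "matching ?N1" "\<Union>?N1 = \<Union>M1 - {b, x}" "card M1 = Suc (card ?N1)"
    using matching_subset[OF m1, of ?N1] Union_matching_remove[OF m1 x(2)]
      card.remove[OF fin(1) x(2)]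
    by blast+
  show ?case
  proof (cases "x \<in> \<Union>M2")
    case False
    then show ?thesis
      using matching_insert[OF m2 x(1)[symmetric] b2] x
      by (intro disjI1 exI[of _ "insert {b, x} M2"] exI[of _ x]) auto
  next
    case True
    then obtain y where y: "y \<noteq> x" "{x, y} \<in> M2"
      using matching_partner[OF m2] by blast
    then have yb: "y \<noteq> b"
      using b2 by auto
    \<comment> \<open>The alternating path continues from \<open>b\<close> through \<open>x\<close>
      to \<open>y\<close>. Once its first two edges are deleted, \<open>y\<close> takes the role of
      \<open>b\<close>.\<close>
    let ?N2 = "M2 - {{x, y}}"
    have n2: "matching ?N2" "\<Union>?N2 = \<Union>M2 - {x, y}" "card M2 = Suc (card ?N2)"
      using matching_subset[OF m2, of ?N2] Union_matching_remove[OF m2 y(2)]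
      card.remove[OF fin(2) y(2)]
      by blast+
    show ?thesis
    proof (cases "y \<in> \<Union>M1")
      case False
      have "matching (insert {x, y} ?N1)" "card (insert {x, y} ?N1) = card M1"
        using matching_insert[OF n1(1) y(1)[symmetric]] n1 False by auto
      moreover have "\<Union>(insert {x, y} ?N1) = insert y (\<Union>M1 - {b})"
        using n1(2) x by auto
      ultimately show ?thesis
        using False y by (intro disjI2 exI[of _ "insert {x, y} ?N1"] exI[of _ y]) auto
    next
      case True
      then have "y \<in> \<Union>?N1" "y \<notin> \<Union>?N2"
        unfolding n1(2) n2(2) using yb y by auto
      have "card ?N1 < card M1"
        using n1(3) by simp
      then show ?thesis
        using less.hyps[OF \<open>card ?N1 < card M1\<close> n1(1) n2(1) \<open>y \<in> \<Union>?N1\<close> \<open>y \<notin> \<Union>?N2\<close>]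
      proof (elim disjE exE conjE, goal_cases)
        \<comment> \<open>\<open>M\<close> augments \<open>?N2\<close> from \<open>y\<close> to
          \<open>w\<close> and covers neither \<open>b\<close> nor \<open>x\<close>, so adding
          \<open>{b, x}\<close> augments \<open>M2\<close> from \<open>b\<close> to
          \<open>w\<close>.\<close>
        case (1 M w)
        define A B where "A = \<Union>M1" and "B = \<Union>M2"
        have sub: "\<Union>M \<subseteq> (A - {b, x}) \<union> (B - {x, y})"
          using Union_mono[OF 1(2)] n1(2) n2(2) by (simp only: Union_Un_distrib A_def B_def)
        have M: "\<Union>M = (B - {x, y}) \<union> {y, w}" and w: "w \<notin> B - {x, y}"
          using 1(7,5) unfolding n2(2) B_def .
        have B: "b \<notin> B" "x \<in> B" "y \<in> B"
          unfolding B_def using b2 y(2) by blast+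
        have wbx: "w \<noteq> b" "w \<noteq> x" "b \<notin> \<Union>M" "x \<notin> \<Union>M"
          using sub B unfolding M by auto
        have "matching (insert {b, x} M)" "card (insert {b, x} M) = Suc (card M2)"
          using matching_insert[OF 1(3) x(1)[symmetric] wbx(3,4)] 1(4) n2(3) by auto
        moreover have "\<Union>(insert {b, x} M) = B \<union> {b, w}"
          using B unfolding Union_insert M by auto
        moreover have "w \<notin> B"
          using w wbx 1(6) by auto
        moreover have "insert {b, x} M \<subseteq> M1 \<union> M2"
          using 1(2) x(2) by blast
        ultimately show ?case
          unfolding B_def using wbx(1) by blast
      next
        \<comment> \<open>\<open>M\<close> exchanges \<open>y\<close> for \<open>w\<close> in
          \<open>?N1\<close>; adding \<open>{x, y}\<close> covers \<open>x\<close> and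
          \<open>y\<close> again, so only \<open>b\<close> is lost.\<close>
        case (2 M w)
        define A B where "A = \<Union>M1" and "B = \<Union>M2"
        have sub: "\<Union>M \<subseteq> (A - {b, x}) \<union> (B - {x, y})"
          using Union_mono[OF 2(2)] n1(2) n2(2) by (simp only: Union_Un_distrib A_def B_def)
        have M: "\<Union>M = insert w (A - {b, x} - {y})" and w: "w \<notin> A - {b, x}"
          using 2(6,5) unfolding n1(2) A_def .
        have A: "b \<in> A" "x \<in> A" "y \<in> A" "b \<notin> B"
          unfolding A_def B_def using b2 x(2) True by blast+
        have wxy: "w \<noteq> b" "w \<noteq> x" "w \<noteq> y" "x \<notin> \<Union>M" "y \<notin> \<Union>M"
          using sub A w x yb y(1) unfolding M by auto
        have "matching (insert {x, y} M)" "card (insert {x, y} M) = card M1"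
          using matching_insert[OF 2(3) y(1)[symmetric] wxy(4,5)] 2(4) n1(3) by auto
        moreover have "\<Union>(insert {x, y} M) = insert w (A - {b})"
          using A x y(1) yb unfolding Union_insert M by auto
        moreover have "w \<notin> A"
          using w wxy by auto
        moreover have "insert {x, y} M \<subseteq> M1 \<union> M2"
          using 2(2) y(2) by blast
        ultimately show ?case
          unfolding A_def by blast
      qed
    qed
  qed
qed

section \<open>Parity and existence of matchings covering a given set\<close>

lemma even_card_if_matched_within:
  assumes "matching M" "finite A" "\<And>x. x \<in> A \<Longrightarrow> \<exists>y\<in>A. {x, y} \<in> M"
  shows "even (card A)"
proof -
  have "\<Union>{e \<in> M. e \<subseteq> A} = A"
    using assms(3) by blast
  moreover have "matching {e \<in> M. e \<subseteq> A}"
    using assms(1) by (rule matching_subset) auto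
  ultimately show ?thesis
    using card_Union_matching by (metis dvd_triv_left)
qed

lemma matching_Un:
  assumes "matching M" "matching N" "\<Union>M \<inter> \<Union>N = {}"
  shows "matching (M \<union> N)"
  using assms disjoint_union[of M N] unfolding matching_def by (metis UnE finite_UnI)

lemma matching_covering_UN:
  assumes "finite I" "disjoint_family_on A I"
    and "\<And>i. i \<in> I \<Longrightarrow> \<exists>M\<subseteq>E. matching M \<and> \<Union>M = A i"
  shows "\<exists>M\<subseteq>E. matching M \<and> \<Union>M = (\<Union>i\<in>I. A i)"
  using assms
proof (induction I rule: finite_induct)
  case empty
  show ?case
    by (rule exI[of _ "{}"]) (simp add: matching_def)
next
  case (insert i I)
  then obtain M where M: "M \<subseteq> E" "matching M" "\<Union>M = (\<Union>i\<in>I. A i)"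
    using disjoint_family_on_mono[of I "insert i I" A] by blast
  obtain N where N: "N \<subseteq> E" "matching N" "\<Union>N = A i"
    using insert.prems(2) by blast
  have "A i \<inter> (\<Union>j\<in>I. A j) = {}"
    using insert.hyps insert.prems(1) by (auto simp: disjoint_family_on_def)
  then have "matching (N \<union> M)"
    using M N by (intro matching_Un) simp_all
  moreover have "\<Union>(N \<union> M) = (\<Union>j\<in>insert i I. A j)"
    by (simp only: Union_Un_distrib UN_insert M N)
  moreover have "N \<union> M \<subseteq> E"
    using M N by simp
  ultimately show ?case
    by (intro exI[of _ "N \<union> M"] conjI)
qed

lemma ex_matching_covering:
  assumes "finite A" "even (card A)"
  shows "\<exists>M. matching M \<and> \<Union>M = A"
  using assms
proof (induction "card A" arbitrary: A rule: less_induct)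
  case less
  show ?case
  proof (cases "A = {}")
    case True
    then show ?thesis
      by (intro exI[of _ "{}"]) (simp add: matching_def)
  next
    case False
    with less.prems have "card A \<ge> 2"
      by (metis card_0_eq dvd_imp_le not_gr_zero)
    then obtain B where B: "B \<subseteq> A" "card B = 2"
      by (meson obtain_subset_with_card_n)
    then obtain x y where xy: "B = {x, y}" "x \<noteq> y"
      by (auto simp: card_2_iff)
    have "card (A - B) = card A - 2"
      using B less.prems by (simp add: card_Diff_subset finite_subset)
    moreover from this have "even (card (A - B))"
      using less.prems by simp
    ultimately obtain M where M: "matching M" "\<Union>M = A - B"
      using less.hyps[of "A - B"] less.prems(1) \<open>card A \<ge> 2\<close>
      by (metis diff_less finite_Diff order.strict_trans2 pos2)
    then have "matching (insert B M)"
      using matching_insert(1)[OF M(1) xy(2)] xy by simp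
    moreover have "\<Union>(insert B M) = A"
      unfolding Union_insert M(2) using B(1) by blast
    ultimately show ?thesis
      by (intro exI[of _ "insert B M"] conjI)
  qed
qed

section \<open>The structure of saturated graphs\<close>

text \<open>The join of the complete graph on \<open>U\<close> with disjoint cliques, which are the
  fibres of \<open>f\<close> on \<open>V - U\<close>. The label type is free: labels can be the
  cliques themselves or numbers.\<close>

definition clique_join :: "'a set \<Rightarrow> 'a set \<Rightarrow> ('a \<Rightarrow> 'b) \<Rightarrow> 'a set set" where
  "clique_join V U f =
     {{x, y} | x y. x \<in> V \<and> y \<in> V \<and> x \<noteq> y \<and> (x \<in> U \<or> y \<in> U \<or> f x = f y)}"

lemma pair_in_clique_join_iff:
  "{x, y} \<in> clique_join V U f
     \<longleftrightarrow> x \<in> V \<and> y \<in> V \<and> x \<noteq> y \<and> (x \<in> U \<or> y \<in> U \<or> f x = f y)"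
  unfolding clique_join_def doubleton_eq_iff by (smt (verit) mem_Collect_eq doubleton_eq_iff)

section \<open>Maximum matchings of a saturated graph\<close>

locale saturated_graph =
  fixes V :: "'a set" and E :: "'a set set" and p k :: nat
  assumes graph: "simple_graph V E"
    and saturated: "matching_saturated (p + 1) V E"
    and card_V: "card V = 2 * p + k"
    and k_ge_2: "k \<ge> 2"
begin

lemma finite_V: "finite V"
  using graph by (simp add: simple_graph_def)

lemma edge_ends: "{x, y} \<in> E \<Longrightarrow> x \<in> V \<and> y \<in> V \<and> x \<noteq> y"
  using graph unfolding simple_graph_def by (force simp: card_insert_if)

text \<open>Saturation excludes size \<open>p + 1\<close>, hence every larger size too, and size
  \<open>p\<close> occurs by \<open>ex_max_matching\<close>.\<close>

definition max_matching :: "'a set set \<Rightarrow> bool" where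
  "max_matching M \<longleftrightarrow> M \<subseteq> E \<and> matching M \<and> card M = p"

lemma no_larger_matching: "M \<subseteq> E \<Longrightarrow> matching M \<Longrightarrow> card M \<noteq> Suc p"
  using saturated graph has_matching_iff[of E]
  unfolding matching_saturated_def simple_graph_def by auto

lemma max_matching_covers: "max_matching M \<Longrightarrow> \<Union>M \<subseteq> V"
  using graph by (auto simp: simple_graph_def max_matching_def)

lemma card_missed:
  assumes "max_matching M"
  shows "card (V - \<Union>M) = k"
proof -
  have "card (\<Union>M) = 2 * p"
    using assms card_Union_matching by (auto simp: max_matching_def)
  then show ?thesis
    using card_V finite_V max_matching_covers[OF assms]
    by (simp add: card_Diff_subset finite_subset)
qed

lemma missed_nonadjacent:
  assumes "max_matching M" "x \<notin> \<Union>M" "y \<notin> \<Union>M"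
  shows "{x, y} \<notin> E"
proof
  assume xy: "{x, y} \<in> E"
  then have "x \<noteq> y"
    using edge_ends by blast
  then have "matching (insert {x, y} M)" "card (insert {x, y} M) = Suc p"
    using matching_insert[of M x y] assms by (auto simp: max_matching_def)
  then show False
    using no_larger_matching xy assms(1) by (auto simp: max_matching_def)
qed

text \<open>The matching of size \<open>p + 1\<close> that appears with the new edge must use this
  edge; deleting it leaves both ends missed.\<close>

lemma nonadjacent_missed:
  assumes "x \<in> V" "y \<in> V" "x \<noteq> y" "{x, y} \<notin> E"
  obtains M where "max_matching M" "x \<notin> \<Union>M" "y \<notin> \<Union>M"
proof -
  have "\<forall>e \<in> insert {x, y} E. card e = 2"
    using graph assms by (auto simp: simple_graph_def)
  moreover have "has_matching (insert {x, y} E) (Suc p)"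
    using saturated assms by (auto simp: matching_saturated_def)
  ultimately obtain M where M: "M \<subseteq> insert {x, y} E" "matching M" "card M = Suc p"
    by (auto simp: has_matching_iff)
  then have xy: "{x, y} \<in> M"
    using no_larger_matching by blast
  have "max_matching (M - {{x, y}})"
    using M xy matching_subset[of M "M - {{x, y}}"] by (auto simp: max_matching_def)
  moreover have "\<Union>(M - {{x, y}}) = \<Union>M - {x, y}"
    using Union_matching_remove M xy by blast
  ultimately show thesis
    using that by (metis Diff_iff insertCI)
qed

text \<open>A nonadjacent pair provides one. There is such a pair, since \<open>k \<ge> 2\<close>
  leaves room for \<open>p + 1\<close> disjoint edges in a complete graph on
  \<open>V\<close>.\<close>

lemma ex_max_matching:
  obtains M where "max_matching M"
proof (cases "\<exists>x\<in>V. \<exists>y\<in>V. x \<noteq> y \<and> {x, y} \<notin> E")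
  case True
  then show thesis
    using nonadjacent_missed that by metis
next
  case False
  have "2 * Suc p \<le> card V"
    using card_V k_ge_2 by simp
  then obtain A where A: "A \<subseteq> V" "card A = 2 * Suc p"
    by (meson obtain_subset_with_card_n)
  then obtain M where M: "matching M" "\<Union>M = A"
    using ex_matching_covering[of A] finite_V finite_subset by auto
  have "M \<subseteq> E"
  proof
    fix e assume e: "e \<in> M"
    then have "card e = 2"
      using M by (simp add: matching_def)
    moreover have "e \<subseteq> V"
      using e M A by blast
    ultimately show "e \<in> E"
      using False by (auto simp: card_2_iff)
  qed
  moreover have "card M = Suc p"
    using card_Union_matching[OF M(1)] M A by simp
  ultimately show thesis
    using no_larger_matching M by blast
qed

text \<open>Replacing \<open>{x, y}\<close> by \<open>{x, v}\<close> moves the gap from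
  \<open>v\<close> to \<open>y\<close>. This serves to show that \<open>y\<close> is not universal,
  or to make \<open>y\<close> a missed vertex.\<close>

lemma max_matching_swap:
  assumes M: "max_matching M" and xy: "{x, y} \<in> M" and v: "v \<in> V - \<Union>M" "{x, v} \<in> E"
  obtains M' where "max_matching M'" "\<Union>M' = insert v (\<Union>M - {y})" "M - {{x, y}} \<subseteq> M'"
proof
  let ?N = "M - {{x, y}}"
  have m: "matching M" "M \<subseteq> E" "card M = p" "finite M"
    using M by (auto simp: max_matching_def matching_def)
  have xny: "x \<noteq> y"
    using xy m edge_ends by blast
  have n: "matching ?N" "\<Union>?N = \<Union>M - {x, y}" "p = Suc (card ?N)"
    using matching_subset[OF m(1), of ?N] Union_matching_remove[OF m(1) xy]
      card.remove[OF m(4) xy] m(3) by blast+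
  have x: "x \<in> \<Union>M"
    using xy by blast
  then have "matching (insert {x, v} ?N)" "card (insert {x, v} ?N) = p"
    using matching_insert[OF n(1), of x v] n(2,3) v by auto
  then show "max_matching (insert {x, v} ?N)"
    using m v by (auto simp: max_matching_def)
  show "\<Union>(insert {x, v} ?N) = insert v (\<Union>M - {y})"
    unfolding Union_insert n(2) using x xny by blast
qed blast

section \<open>Universal vertices and the cliques outside them\<close>

definition universal :: "'a set" where
  "universal = {u \<in> V. \<forall>v\<in>V. v \<noteq> u \<longrightarrow> {u, v} \<in> E}"

lemma universal_adjacent: "u \<in> universal \<Longrightarrow> v \<in> V \<Longrightarrow> v \<noteq> u \<Longrightarrow> {u, v} \<in> E"
  by (simp add: universal_def)

text \<open>As \<open>k \<ge> 2\<close>, a missed \<open>u\<close> would come with a second missed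
  vertex, and the two would be nonadjacent.\<close>

lemma universal_covered:
  assumes "max_matching M" "u \<in> universal"
  shows "u \<in> \<Union>M"
proof (rule ccontr)
  assume u: "u \<notin> \<Union>M"
  have "card (V - \<Union>M - {u}) \<noteq> 0"
    using card_missed[OF assms(1)] k_ge_2 card_Diff_singleton_if[of "V - \<Union>M" u]
    by (simp split: if_splits)
  then obtain v where "v \<in> V - \<Union>M - {u}"
    by (metis card.empty ex_in_conv)
  then show False
    using u universal_adjacent[OF assms(2), of v] missed_nonadjacent[OF assms(1)] by blast
qed

lemma ex_matching_missing:
  assumes "x \<in> V - universal"
  obtains M where "max_matching M" "x \<notin> \<Union>M"
  using assms nonadjacent_missed unfolding universal_def by blast

text \<open>Gallai's lemma for the relation of being missed by no common maximum matching,
  which is adjacency in a saturated graph.\<close>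

lemma adjacent_trans:
  assumes b: "b \<in> V - universal" and ab: "{a, b} \<in> E" and bc: "{b, c} \<in> E" and ac: "a \<noteq> c"
  shows "{a, c} \<in> E"
proof (rule ccontr)
  assume "{a, c} \<notin> E"
  then obtain M where M: "max_matching M" "a \<notin> \<Union>M" "c \<notin> \<Union>M"
    using nonadjacent_missed[of a c] ab bc ac edge_ends by metis
  then have "b \<in> \<Union>M"
    using missed_nonadjacent ab by blast
  obtain M2 where M2: "max_matching M2" "b \<notin> \<Union>M2"
    using ex_matching_missing[OF b] by blast
  have m: "matching M" "matching M2" "M \<subseteq> E" "M2 \<subseteq> E" "card M = p" "card M2 = p"
    using M M2 by (simp_all add: max_matching_def)
  note exchange = matching_exchange[OF m(1,2) \<open>b \<in> \<Union>M\<close> M2(2)]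
  consider N where "N \<subseteq> M \<union> M2" "matching N" "card N = Suc (card M2)"
    | N w where "N \<subseteq> M \<union> M2" "matching N" "card N = card M" "w \<notin> \<Union>M"
        "\<Union>N = insert w (\<Union>M - {b})"
    using exchange by metis
  then show False
  proof cases
    case (1 N)
    then have "N \<subseteq> E" "card N = Suc p"
      using m by auto
    then show ?thesis
      using no_larger_matching 1(2) by simp
  next
    case (2 N w)
    have "N \<subseteq> E"
      using 2(1) m(3,4) by (meson Un_least order_trans)
    then have "max_matching N"
      using 2(2,3) m(5) by (simp add: max_matching_def)
    \<comment> \<open>\<open>w\<close> is the only new vertex covered by \<open>N\<close>, so at
      least one of \<open>a\<close> and \<open>c\<close> stays missed, now together with its
      neighbour \<open>b\<close>.\<close>
    moreover have "b \<notin> \<Union>N" "a \<notin> \<Union>N \<or> c \<notin> \<Union>N"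
      unfolding 2(5) using 2(4) \<open>b \<in> \<Union>M\<close> M(2,3) ac by (metis Diff_iff insert_iff)+
    ultimately show ?thesis
      using missed_nonadjacent ab bc by metis
  qed
qed

text \<open>The closed neighbourhood outside \<open>universal\<close>; for \<open>x\<close> outside
  \<open>universal\<close> it is an equivalence class, by \<open>adjacent_trans\<close>.\<close>

definition clique :: "'a \<Rightarrow> 'a set" where
  "clique x = {y \<in> V - universal. y = x \<or> {x, y} \<in> E}"

lemma clique_eq_iff:
  assumes "x \<in> V - universal" "y \<in> V - universal"
  shows "clique x = clique y \<longleftrightarrow> x = y \<or> {x, y} \<in> E"
proof
  assume "clique x = clique y"
  moreover have "y \<in> clique y"
    using assms by (simp add: clique_def)
  ultimately show "x = y \<or> {x, y} \<in> E"
    by (auto simp: clique_def)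
next
  have "clique x \<subseteq> clique y" if "x \<in> V - universal" "{x, y} \<in> E" for x y
    using that adjacent_trans[of x y] by (fastforce simp: clique_def insert_commute)
  then show "clique x = clique y" if "x = y \<or> {x, y} \<in> E"
    using that assms by (metis insert_commute subset_antisym)
qed

lemma in_clique_iff:
  assumes "x \<in> V - universal"
  shows "y \<in> clique x \<longleftrightarrow> y \<in> V - universal \<and> clique y = clique x"
  using assms clique_eq_iff[of x y] by (auto simp: clique_def)

lemma eq_clique_join: "E = clique_join V universal clique"
proof (intro set_eqI iffI)
  fix e assume e: "e \<in> E"
  then obtain x y where xy: "e = {x, y}"
    using graph by (auto simp: simple_graph_def card_2_iff)
  with e have "x \<in> V" "y \<in> V" "x \<noteq> y"
    using edge_ends by blast+
  with e xy show "e \<in> clique_join V universal clique"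
    using clique_eq_iff[of x y] by (auto simp: pair_in_clique_join_iff)
next
  fix e assume "e \<in> clique_join V universal clique"
  then obtain x y where xy: "e = {x, y}" "x \<in> V" "y \<in> V" "x \<noteq> y"
    "x \<in> universal \<or> y \<in> universal \<or> clique x = clique y"
    by (auto simp: clique_join_def)
  then show "e \<in> E"
    using clique_eq_iff[of x y] universal_adjacent[of x y] universal_adjacent[of y x]
    by (auto simp: insert_commute)
qed

section \<open>Parity and number of the cliques\<close>

text \<open>Swapping \<open>{x, y}\<close> for \<open>{x, v}\<close> yields a maximum matching that
  misses \<open>y\<close>. Hence \<open>y\<close> is not universal and, being adjacent to
  \<open>x\<close>, lies in the same clique.\<close>

lemma missed_clique_matched_within:
  assumes M: "max_matching M" and v: "v \<in> V - \<Union>M" and x: "x \<in> clique v - {v}"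
    and xy: "{x, y} \<in> M"
  shows "y \<in> clique v - {v}"
proof -
  have vx: "{x, v} \<in> E"
    using x by (auto simp: clique_def insert_commute)
  have vU: "v \<in> V - universal"
    using v universal_covered[OF M] by blast
  have xU: "x \<in> V - universal"
    using x by (auto simp: clique_def)
  have xyE: "{x, y} \<in> E"
    using xy M by (auto simp: max_matching_def)
  obtain M' where M': "max_matching M'" "\<Union>M' = insert v (\<Union>M - {y})"
    using max_matching_swap[OF M xy v vx] by metis
  have yv: "y \<noteq> v"
    using xy v by blast
  then have "y \<notin> \<Union>M'"
    unfolding M'(2) by simp
  then have "y \<in> V - universal"
    using universal_covered[OF M'(1)] edge_ends[OF xyE] by blast
  then have "clique y = clique x"
    using clique_eq_iff[OF _ xU] xyE by (auto simp: insert_commute)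
  moreover have "clique x = clique v"
    using clique_eq_iff[OF xU vU] vx by simp
  ultimately show ?thesis
    using in_clique_iff[OF vU] \<open>y \<in> V - universal\<close> yv by simp
qed

lemma missed_clique_unique:
  assumes "max_matching M" "v \<in> V - \<Union>M" "v' \<in> V - \<Union>M" "clique v = clique v'"
  shows "v = v'"
proof -
  have "v \<in> V - universal" "v' \<in> V - universal"
    using assms universal_covered by blast+
  then show ?thesis
    using clique_eq_iff[of v v'] missed_nonadjacent[OF assms(1), of v v'] assms by blast
qed

lemma odd_clique:
  assumes "x \<in> V - universal"
  shows "odd (card (clique x))"
proof -
  obtain M where M: "max_matching M" "x \<notin> \<Union>M"
    using ex_matching_missing[OF assms] by blast
  have fin: "finite (clique x)"
    using finite_V by (simp add: clique_def)
  have "even (card (clique x - {x}))"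
  proof (rule even_card_if_matched_within)
    show "matching M"
      using M by (simp add: max_matching_def)
    fix y assume y: "y \<in> clique x - {x}"
    then have "{x, y} \<in> E"
      by (auto simp: clique_def)
    then have "y \<in> \<Union>M"
      using missed_nonadjacent[OF M(1)] M(2) by blast
    then obtain z where "{y, z} \<in> M"
      using matching_partner[OF \<open>matching M\<close>] by metis
    then show "\<exists>z\<in>clique x - {x}. {y, z} \<in> M"
      using missed_clique_matched_within[OF M(1) _ y] M(2) assms by blast
  qed (use fin in simp)
  moreover have "card (clique x) = Suc (card (clique x - {x}))"
    using fin assms by (intro card.remove) (auto simp: clique_def)
  ultimately show ?thesis
    by simp
qed

text \<open>For a fixed maximum matching, \<open>g\<close> sends a missed vertex to its clique and a
  universal vertex to the clique of its partner. This is a bijection onto the cliques.\<close>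

lemma card_cliques: "card (clique ` (V - universal)) = card universal + k"
proof -
  obtain M where M: "max_matching M"
    using ex_max_matching by blast
  then have m: "matching M" "M \<subseteq> E"
    by (auto simp: max_matching_def)
  define partner where "partner u = (SOME y. {u, y} \<in> M)" for u
  have partner: "{u, partner u} \<in> M" if "u \<in> universal" for u
    using matching_partner[OF m(1) universal_covered[OF M that]] unfolding partner_def
    by (metis someI_ex)
  obtain v0 where v0: "v0 \<in> V - \<Union>M"
    using card_missed[OF M] k_ge_2 by (metis card.empty ex_in_conv not_numeral_le_zero)
  have missedU: "v \<in> V - universal" if "v \<in> V - \<Union>M" for v
    using that universal_covered[OF M] by blast
  \<comment> \<open>Each universal \<open>u\<close> is adjacent to the missed vertex
    \<open>v0\<close>, so the gap can be moved from \<open>v0\<close> to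
    \<open>partner u\<close>.\<close>
  have partner_swap: "\<exists>M'. max_matching M' \<and> \<Union>M' = insert v0 (\<Union>M - {partner u})
      \<and> M - {{u, partner u}} \<subseteq> M'" if "u \<in> universal" for u
  proof -
    have "{u, v0} \<in> E"
      using universal_adjacent[OF that, of v0] v0 universal_covered[OF M that] by blast
    then show ?thesis
      using max_matching_swap[OF M partner[OF that] v0] by metis
  qed
  have partnerU: "partner u \<in> V - universal" if u: "u \<in> universal" for u
  proof -
    obtain M' where M': "max_matching M'" "\<Union>M' = insert v0 (\<Union>M - {partner u})"
      using partner_swap[OF u] by blast
    have "partner u \<noteq> v0"
      using partner[OF u] v0 by blast
    then have "partner u \<notin> \<Union>M'"
      unfolding M'(2) by simp
    then show ?thesis
      using universal_covered[OF M'(1)] edge_ends partner[OF u] m(2) by blast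
  qed
  define g where "g w = clique (if w \<in> universal then partner w else w)" for w
  have g_missed: "g v = clique v" if "v \<in> V - \<Union>M" for v
    using missedU[OF that] by (simp add: g_def)
  have g_univ: "g u = clique (partner u)" if "u \<in> universal" for u
    using that by (simp add: g_def)
  \<comment> \<open>The clique of a missed \<open>v\<close> is matched within itself apart from
    \<open>v\<close>; if it contained \<open>partner u\<close>, it would contain
    \<open>u\<close>.\<close>
  have ne1: "g v \<noteq> g u" if v: "v \<in> V - \<Union>M" and u: "u \<in> universal" for u v
  proof
    assume "g v = g u"
    then have "partner u \<in> clique v"
      using in_clique_iff[OF missedU[OF v]] partnerU[OF u] g_missed[OF v] g_univ[OF u] by simp
    moreover have "partner u \<noteq> v"
      using partner[OF u] v by blast
    moreover have "{partner u, u} \<in> M"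
      using partner[OF u] by (simp add: insert_commute)
    ultimately have "u \<in> clique v - {v}"
      using missed_clique_matched_within[OF M v] by blast
    then show False
      using u by (simp add: clique_def)
  qed
  \<comment> \<open>After the swap at \<open>u\<close>, \<open>partner u\<close> is missed while the
    edge at \<open>u'\<close> survives, which reduces this to the argument of
    \<open>ne1\<close>.\<close>
  have ne2: "u = u'" if u: "u \<in> universal" "u' \<in> universal" and eq: "g u = g u'" for u u'
  proof (rule ccontr)
    assume neq: "u \<noteq> u'"
    obtain M' where M': "max_matching M'" "\<Union>M' = insert v0 (\<Union>M - {partner u})"
        "M - {{u, partner u}} \<subseteq> M'"
      using partner_swap[OF u(1)] by blast
    have "partner u \<noteq> v0"
      using partner[OF u(1)] v0 by blast
    then have v: "partner u \<in> V - \<Union>M'"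
      unfolding M'(2) using partnerU[OF u(1)] by simp
    have "{u', partner u'} \<noteq> {u, partner u}"
      using neq u partnerU[OF u(1)] by (auto simp: doubleton_eq_iff)
    then have "{partner u', u'} \<in> M'"
      using M'(3) partner[OF u(2)] by (auto simp: insert_commute)
    moreover have "partner u' \<noteq> partner u"
      using neq matching_partner_unique[OF m(1), of "partner u" u u'] partner u
      by (metis insert_commute)
    moreover have "partner u' \<in> clique (partner u)"
      using in_clique_iff[OF partnerU[OF u(1)]] partnerU[OF u(2)] eq u g_univ by simp
    ultimately have "u' \<in> clique (partner u) - {partner u}"
      using missed_clique_matched_within[OF M'(1) v] by blast
    then show False
      using u by (simp add: clique_def)
  qed
  have "inj_on g ((V - \<Union>M) \<union> universal)"
  proof (rule inj_onI)
    fix x y assume xy: "x \<in> (V - \<Union>M) \<union> universal" "y \<in> (V - \<Union>M) \<union> universal" "g x = g y"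
    consider "x \<in> universal" "y \<in> universal" | "x \<in> V - \<Union>M" "y \<in> universal"
      | "x \<in> universal" "y \<in> V - \<Union>M" | "x \<in> V - \<Union>M" "y \<in> V - \<Union>M"
      using xy(1,2) by blast
    then show "x = y"
    proof cases
      case 1
      then show ?thesis
        using ne2[OF _ _ xy(3)] by simp
    next
      case 2
      then show ?thesis
        using ne1[OF 2] xy(3) by simp
    next
      case 3
      then show ?thesis
        using ne1[OF 3(2,1)] xy(3) by simp
    next
      case 4
      then show ?thesis
        using missed_clique_unique[OF M 4] g_missed xy(3) by metis
    qed
  qed
  moreover have "g ` ((V - \<Union>M) \<union> universal) = clique ` (V - universal)"
  proof (intro equalityI subsetI)
    fix C assume "C \<in> g ` ((V - \<Union>M) \<union> universal)"
    then obtain w where w: "w \<in> (V - \<Union>M) \<union> universal" "C = g w"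
      by (rule imageE)
    show "C \<in> clique ` (V - universal)"
    proof (cases "w \<in> universal")
      case True
      then show ?thesis
        using g_univ partnerU w(2) by simp
    next
      case False
      then show ?thesis
        using w missedU g_missed by (metis UnE imageI)
    qed
  next
    fix C assume "C \<in> clique ` (V - universal)"
    then obtain x where x: "x \<in> V - universal" "C = clique x"
      by blast
    show "C \<in> g ` ((V - \<Union>M) \<union> universal)"
    proof (rule ccontr)
      assume C: "C \<notin> g ` ((V - \<Union>M) \<union> universal)"
      \<comment> \<open>A clique not hit by \<open>g\<close> contains neither a missed vertex nor a
        partner of a universal one, so \<open>M\<close> matches it within itself.\<close>
      have "even (card C)"
      proof (rule even_card_if_matched_within[OF m(1)])
        show "finite C"
          using x finite_V by (simp add: clique_def)
        fix y assume "y \<in> C"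
        then have y: "y \<in> V - universal" "clique y = C"
          using x in_clique_iff by blast+
        have "y \<in> \<Union>M"
          using C g_missed[of y] y by (metis DiffD1 DiffI UnI1 imageI)
        then obtain z where z: "{y, z} \<in> M"
          using matching_partner[OF m(1)] by metis
        have "z \<notin> universal"
        proof
          assume zU: "z \<in> universal"
          then have "partner z = y"
            using matching_partner_unique[OF m(1), of z "partner z" y] partner z
            by (simp add: insert_commute)
          then show False
            using C zU g_univ[OF zU] y by (metis UnI2 imageI)
        qed
        then have "z \<in> C"
          using z m(2) edge_ends[of y z] y by (auto simp: clique_def)
        then show "\<exists>z\<in>C. {y, z} \<in> M"
          using z by blast
      qed
      then show False
        using odd_clique x by simp
    qed
  qed
  ultimately have "card (clique ` (V - universal)) = card ((V - \<Union>M) \<union> universal)"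
    by (metis card_image)
  also have "\<dots> = card (V - \<Union>M) + card universal"
    using finite_V missedU by (intro card_Un_disjoint) (auto simp: universal_def)
  finally show ?thesis
    using card_missed[OF M] by simp
qed

end

section \<open>Minimizing the number of edges\<close>

text \<open>The least sum of squares of \<open>s\<close> integers with sum \<open>N = u * s + b\<close>, \<open>0 \<le> b < s\<close>, which is
  \<open>s * u\<^sup>2 + b * (2 * u + 1)\<close>. The form below is the sum of the chords \<open>(2 * u + 1) * c - u * (u + 1)\<close>
  of the parabola, each below \<open>c\<^sup>2\<close> at the integers.\<close>

definition min_sq :: "int \<Rightarrow> int \<Rightarrow> int" where
  "min_sq N s = (2 * (N div s) + 1) * N - (N div s) * (N div s + 1) * s"

text \<open>With \<open>u = N div s\<close> the difference of the two sides is
  \<open>(u - v) * (2 * N - (u + v + 1) * s)\<close>. The factors never have opposite signs because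
  \<open>N\<close> lies between \<open>u * s\<close> and \<open>(u + 1) * s\<close>.\<close>

lemma min_sq_ge_chord:
  assumes "s > 0"
  shows "(2 * v + 1) * N - v * (v + 1) * s \<le> min_sq N s"
proof -
  define u where "u = N div s"
  have "N = u * s + N mod s"
    by (simp add: u_def)
  then have u: "u * s \<le> N" "N < (u + 1) * s"
    using pos_mod_sign[OF assms, of N] pos_mod_bound[OF assms, of N]
    by (simp_all add: distrib_right)
  have "0 \<le> (u - v) * (2 * N - (u + v + 1) * s)"
  proof (cases u v rule: linorder_cases)
    case less
    have "(2 * u + 2) * s \<le> (u + v + 1) * s"
      using less assms by (intro mult_right_mono) auto
    then have "2 * N - (u + v + 1) * s \<le> 0"
      using u by (simp add: algebra_simps)
    then show ?thesis
      using less by (intro mult_nonpos_nonpos) auto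
  next
    case greater
    have "(u + v + 1) * s \<le> (2 * u) * s"
      using greater assms by (intro mult_right_mono) auto
    then have "2 * N - (u + v + 1) * s \<ge> 0"
      using u by (simp add: algebra_simps)
    then show ?thesis
      using greater by (intro mult_nonneg_nonneg) auto
  qed simp
  then show ?thesis
    unfolding min_sq_def u_def[symmetric] by (simp add: algebra_simps)
qed

lemma min_sq_le_sum_squares:
  fixes c :: "'i \<Rightarrow> int"
  shows "min_sq (\<Sum>i\<in>I. c i) (int (card I)) \<le> (\<Sum>i\<in>I. (c i)\<^sup>2)"
proof -
  define u where "u = (\<Sum>i\<in>I. c i) div int (card I)"
  have "(2 * u + 1) * c i - u * (u + 1) \<le> (c i)\<^sup>2" for i
  proof -
    \<comment> \<open>No integer lies strictly between \<open>u\<close> and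
      \<open>u + 1\<close>.\<close>
    have "0 \<le> (c i - u) * (c i - (u + 1))"
      by (cases "c i \<le> u") (auto intro: mult_nonpos_nonpos mult_nonneg_nonneg)
    then show ?thesis
      by (simp add: algebra_simps power2_eq_square)
  qed
  then have "(\<Sum>i\<in>I. (2 * u + 1) * c i - u * (u + 1)) \<le> (\<Sum>i\<in>I. (c i)\<^sup>2)"
    by (rule sum_mono)
  then show ?thesis
    by (simp add: min_sq_def u_def[symmetric] sum_subtractf sum_distrib_left sum_distrib_right mult_ac)
qed

text \<open>\<open>N mod s\<close> of the parts are \<open>N div s + 1\<close>, the others
  \<open>N div s\<close>. The lower bound on the parts later keeps the cliques nonempty.\<close>

lemma min_sq_attained:
  fixes N s :: nat
  assumes "s > 0"
  obtains c :: "nat \<Rightarrow> nat" where "(\<Sum>i<s. c i) = N" "(\<Sum>i<s. int (c i) ^ 2) = min_sq N s"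
    "\<And>i. N div s \<le> c i"
proof
  define u b where "u = N div s" and "b = N mod s"
  let ?c = "\<lambda>i. u + of_bool (i < b)"
  have b: "b < s" and N: "N = u * s + b"
    using assms by (simp_all add: u_def b_def)
  have bs: "{i. i < b} = {..<b}"
    by auto
  have sb: "(\<Sum>i<s. of_bool (i < b) :: nat) = b" "(\<Sum>i<s. of_bool (i < b) :: int) = int b"
    using b by (simp_all add: sum.If_cases of_bool_def bs Int_absorb1)
  show "(\<Sum>i<s. ?c i) = N"
    by (simp add: sum.distrib sb N)
  have "int (?c i) ^ 2 = int u ^ 2 + (2 * int u + 1) * of_bool (i < b)" for i
    by (simp add: power2_eq_square algebra_simps)
  then have "(\<Sum>i<s. int (?c i) ^ 2) = int s * int u ^ 2 + (2 * int u + 1) * int b"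
    by (simp add: sum.distrib sb sum_distrib_left[symmetric])
  also have "\<dots> = min_sq N s"
  proof -
    have "int N div int s = int u"
      by (simp add: u_def zdiv_int)
    then show ?thesis
      by (simp add: min_sq_def N algebra_simps power2_eq_square)
  qed
  finally show "(\<Sum>i<s. int (?c i) ^ 2) = min_sq N s" .
  show "N div s \<le> ?c i" for i
    by (simp add: u_def)
qed

section \<open>Monotonicity of the edge count in the number of universal vertices\<close>

text \<open>For \<open>N = p + k\<close> and \<open>s = k + z\<close> the conclusion says that
  \<open>twice_edges\<close> does not decrease from \<open>z\<close> to \<open>z + 1\<close>. A
  suitable chord bounds \<open>min_sq N (s + 1)\<close> from below.\<close>

lemma min_sq_drop_le:
  assumes "s \<ge> 1" "2 * N \<le> 2 * s\<^sup>2 - s" "s + 1 \<le> N"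
  shows "2 * (min_sq N s - min_sq N (s + 1)) \<le> 2 * N - s"
proof -
  define u r where "u = N div s" and "r = N mod s"
  have r: "0 \<le> r" "r < s" and N: "N = u * s + r"
    using assms by (simp_all add: u_def r_def)
  have S: "min_sq N s = (2 * u + 1) * N - u * (u + 1) * s"
    by (simp add: min_sq_def u_def)
  have u1: "u \<ge> 1"
  proof (rule ccontr)
    assume "\<not> ?thesis"
    then have "u * s \<le> 0"
      using assms(1) by (simp add: mult_nonpos_nonneg)
    then show False
      using N r assms by simp
  qed
  have us: "u \<le> s - 1"
  proof (rule ccontr)
    assume "\<not> ?thesis"
    then have "s * s \<le> u * s"
      using assms(1) by (intro mult_right_mono) auto
    then show False
      using N r assms by (simp only: power2_eq_square distrib_left)
  qed
  show ?thesis
  proof (cases "u = s - 1")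
    case True
    \<comment> \<open>\<open>N / (s + 1)\<close> lies between \<open>s - 2\<close> and \<open>s - 1 = u\<close>, so the chord at \<open>u\<close> is too weak.\<close>
    have "(2 * (s - 2) + 1) * N - (s - 2) * (s - 2 + 1) * (s + 1) \<le> min_sq N (s + 1)"
      using assms by (intro min_sq_ge_chord) simp
    moreover have "2 * N \<le> 2 * s\<^sup>2 + s - 4"
      using assms u1 us by simp
    ultimately show ?thesis
      unfolding S True by (simp add: algebra_simps power2_eq_square)
  next
    case False
    have "(2 * u + 1) * N - u * (u + 1) * (s + 1) \<le> min_sq N (s + 1)"
      using assms by (intro min_sq_ge_chord) simp
    then have "min_sq N s - min_sq N (s + 1) \<le> u * (u + 1)"
      unfolding S by (simp add: algebra_simps)
    \<comment> \<open>Now \<open>s \<ge> u + 2\<close>, so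
      \<open>2 * N - s \<ge> (2 * u - 1) * (u + 2)\<close>, which suffices for
      \<open>u \<ge> 2\<close>. For \<open>u = 1\<close>, the bound \<open>s + 1 \<le> N\<close>
      gives \<open>r \<ge> 1\<close>.\<close>
    moreover have "2 * (u * (u + 1)) \<le> 2 * N - s"
    proof (cases "u = 1")
      case True
      then show ?thesis
        using N r assms False us by simp
    next
      case f2: False
      have "(2 * u - 1) * (u + 2) \<le> (2 * u - 1) * s"
        using False us u1 by (intro mult_left_mono) auto
      then show ?thesis
        using N r f2 u1 by (simp add: algebra_simps)
    qed
    ultimately show ?thesis
      by simp
  qed
qed

text \<open>The counterpart below the root: for \<open>t = k + z\<close>, \<open>twice_edges\<close>
  does not increase from \<open>z - 1\<close> to \<open>z\<close>.\<close>

lemma min_sq_drop_ge: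
  assumes "t \<ge> 2" "2 * N \<ge> 2 * t\<^sup>2 - t"
  shows "2 * (min_sq N (t - 1) - min_sq N t) \<ge> 2 * N - (t - 1)"
proof -
  define u r where "u = N div t" and "r = N mod t"
  have r: "0 \<le> r" "r < t" and N: "N = u * t + r"
    using assms by (simp_all add: u_def r_def)
  have S: "min_sq N t = (2 * u + 1) * N - u * (u + 1) * t"
    by (simp add: min_sq_def u_def)
  have ut: "u \<ge> t - 1"
  proof (rule ccontr)
    assume "\<not> ?thesis"
    then have "u * t \<le> (t - 2) * t"
      using assms(1) by (intro mult_right_mono) auto
    then show False
      using N r assms by (simp add: power2_eq_square algebra_simps)
  qed
  show ?thesis
  proof (cases "u = t - 1")
    case True
    \<comment> \<open>The chord at \<open>u = t - 1\<close> is too weak for \<open>t \<le> 2 * r\<close>.\<close>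
    have "(2 * t + 1) * N - t * (t + 1) * (t - 1) \<le> min_sq N (t - 1)"
      using assms by (intro min_sq_ge_chord) simp
    then show ?thesis
      unfolding S True using assms by (simp add: algebra_simps power2_eq_square)
  next
    case False
    have "(2 * u + 1) * N - u * (u + 1) * (t - 1) \<le> min_sq N (t - 1)"
      using assms by (intro min_sq_ge_chord) simp
    then have "u * u + u \<le> min_sq N (t - 1) - min_sq N t"
      unfolding S by (simp add: algebra_simps)
    \<comment> \<open>For \<open>u \<ge> t\<close>, \<open>2 * (u * u + u)\<close> is at least
      \<open>2 * N - (t - 1) = 2 * u * t + 2 * r - t + 1\<close>.\<close>
    moreover have "u * t \<le> u * u"
      using False ut assms(1) by (intro mult_left_mono) auto
    moreover have "t \<le> u"
      using False ut by simp
    ultimately have "2 * N - (t - 1) \<le> 2 * min_sq N (t - 1) - 2 * min_sq N t"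
      using N r by linarith
    then show ?thesis
      by simp
  qed
qed

text \<open>Twice the number of edges of the join of \<open>K\<^sub>z\<close> with \<open>k + z\<close> disjoint odd cliques of
  almost equal sizes.\<close>

definition twice_edges :: "int \<Rightarrow> int \<Rightarrow> int \<Rightarrow> int" where
  "twice_edges p k z =
     - z\<^sup>2 + (2 * (2 * p + k) + 1) * z + 4 * min_sq (p + k) (k + z) - 3 * (2 * p + k) - k"

text \<open>The threshold \<open>s * (2 * s - 1)\<close> grows with \<open>s\<close>, so the
  condition at \<open>z0\<close> persists at each later \<open>z\<close>; the bound by
  \<open>p\<close> ensures \<open>s + 1 \<le> N\<close>.\<close>

lemma twice_edges_incseq:
  assumes "k \<ge> 1" "0 \<le> z0" "2 * (p + k) \<le> 2 * (k + z0)\<^sup>2 - (k + z0)" "z0 \<le> z" "z \<le> p"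
  shows "twice_edges p k z0 \<le> twice_edges p k z"
  using assms(4,5)
proof (induction z rule: int_ge_induct)
  case (step z)
  have "(k + z0) * (2 * (k + z0) - 1) \<le> (k + z) * (2 * (k + z) - 1)"
    using assms step by (intro mult_mono) auto
  then have "2 * (p + k) \<le> 2 * (k + z)\<^sup>2 - (k + z)"
    using assms(3) by (simp add: power2_eq_square algebra_simps)
  then have "2 * (min_sq (p + k) (k + z) - min_sq (p + k) (k + z + 1)) \<le> 2 * (p + k) - (k + z)"
    using assms step by (intro min_sq_drop_le) auto
  then have "twice_edges p k z \<le> twice_edges p k (z + 1)"
    by (simp add: twice_edges_def power2_eq_square algebra_simps)
  then show ?case
    using step by simp
qed simp

lemma twice_edges_decseq:
  assumes "k \<ge> 1" "2 * (p + k) \<ge> 2 * (k + z1)\<^sup>2 - (k + z1)" "z \<le> z1" "0 \<le> z"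
  shows "twice_edges p k z1 \<le> twice_edges p k z"
  using assms(3,4)
proof (induction z rule: int_le_induct)
  case (step z)
  have "(k + z) * (2 * (k + z) - 1) \<le> (k + z1) * (2 * (k + z1) - 1)"
    using assms step by (intro mult_mono) auto
  then have "2 * (p + k) \<ge> 2 * (k + z)\<^sup>2 - (k + z)"
    using assms(2) by (simp add: power2_eq_square algebra_simps)
  then have "2 * (min_sq (p + k) (k + z - 1) - min_sq (p + k) (k + z)) \<ge> 2 * (p + k) - (k + z - 1)"
    using assms step by (intro min_sq_drop_ge) auto
  then have "twice_edges p k z \<le> twice_edges p k (z - 1)"
    by (simp add: twice_edges_def power2_eq_square algebra_simps)
  then show ?case
    using step by simp
qed simp

section \<open>The closed formula and its critical point\<close>

text \<open>\<open>b_rem\<close> is \<open>N mod s\<close>, since its dividend \<open>p - z\<close>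
  equals \<open>N - s\<close>. The fractions combine by
  \<open>min_sq N s * s = N\<^sup>2 - b\<^sup>2 + b * s\<close>.\<close>

lemma D_eq_twice_edges:
  assumes "k \<ge> 1" "z \<ge> 0"
  shows "D (2 * p + k) k z = of_int (twice_edges (int p) (int k) z)"
proof -
  define N s u b where "N = int p + int k" and "s = int k + z" and "u = N div s" and "b = N mod s"
  have s: "s > 0"
    using assms by (simp add: s_def)
  have N: "N = u * s + b"
    unfolding u_def b_def by simp
  have "(int (2 * p + k) - int k) div 2 - z = N - s"
    by (simp add: N_def s_def)
  then have b: "b_rem (2 * p + k) k z = b"
    by (simp add: b_rem_def s_def[symmetric] b_def)
  have pk: "real p = of_int N - real k" "of_int z = of_int s - real k"
    by (simp_all add: N_def s_def)
  have "(2 * of_int N)\<^sup>2 / of_int s - 4 * (of_int b)\<^sup>2 / of_int s + 4 * of_int b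
      = (4 * of_int (min_sq N s) :: real)"
  proof -
    have "min_sq N s * s = N\<^sup>2 - b\<^sup>2 + b * s"
      unfolding min_sq_def u_def[symmetric] by (simp add: N power2_eq_square algebra_simps)
    then have "of_int (min_sq N s * s) = (of_int (N\<^sup>2 - b\<^sup>2 + b * s) :: real)"
      by simp
    then show ?thesis
      using s by (simp add: field_simps)
  qed
  moreover have "real (2 * p + k) + real k = 2 * of_int N" "real k + of_int z = of_int s"
    by (simp_all add: N_def s_def)
  ultimately show ?thesis
    unfolding D_def b twice_edges_def N_def[symmetric] s_def[symmetric]
    by (simp add: diff_divide_distrib algebra_simps)
qed

text \<open>The radicand is \<open>16 * (p + k) + 1\<close>, and squaring
  \<open>sqrt (16 * N + 1) \<le> 4 * s - 1\<close> leaves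
  \<open>2 * N \<le> 2 * s\<^sup>2 - s\<close>.\<close>

lemma z_dagger_le_iff:
  assumes "k \<ge> 1" "z \<ge> 0"
  shows "z_dagger (2 * p + k) k \<le> of_int z
    \<longleftrightarrow> 2 * (int p + int k) \<le> 2 * (int k + z)\<^sup>2 - (int k + z)"
proof -
  define s where "s = int k + z"
  have s: "real k = of_int s - of_int z" "s \<ge> 1"
    using assms by (simp_all add: s_def)
  have "z_dagger (2 * p + k) k \<le> of_int z \<longleftrightarrow> sqrt (16 * (real p + real k) + 1) \<le> 4 * of_int s - 1"
    by (simp add: z_dagger_def s_def field_simps)
  also have "\<dots> \<longleftrightarrow> 16 * (real p + real k) + 1 \<le> (4 * of_int s - 1)\<^sup>2"
    using s(2) by (auto intro: real_le_lsqrt dest: sqrt_le_D)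
  also have "\<dots> \<longleftrightarrow> of_int (2 * (int p + int k)) \<le> (of_int (2 * s\<^sup>2 - s) :: real)"
    by (simp add: power2_eq_square algebra_simps) linarith
  also have "\<dots> \<longleftrightarrow> 2 * (int p + int k) \<le> 2 * s\<^sup>2 - s"
    by (rule of_int_le_iff)
  finally show ?thesis
    by (simp add: s_def)
qed

lemma le_z_dagger_iff:
  assumes "k \<ge> 1" "z \<ge> 0"
  shows "of_int z \<le> z_dagger (2 * p + k) k
    \<longleftrightarrow> 2 * (int k + z)\<^sup>2 - (int k + z) \<le> 2 * (int p + int k)"
proof -
  define s where "s = int k + z"
  have s: "real k = of_int s - of_int z" "s \<ge> 1"
    using assms by (simp_all add: s_def)
  have "of_int z \<le> z_dagger (2 * p + k) k \<longleftrightarrow> 4 * of_int s - 1 \<le> sqrt (16 * (real p + real k) + 1)"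
    by (simp add: z_dagger_def s_def field_simps)
  also have "\<dots> \<longleftrightarrow> (4 * of_int s - 1)\<^sup>2 \<le> 16 * (real p + real k) + 1"
    using s(2) by (auto intro: real_le_rsqrt dest: power_mono[where n = 2])
  also have "\<dots> \<longleftrightarrow> of_int (2 * s\<^sup>2 - s) \<le> (of_int (2 * (int p + int k)) :: real)"
    by (simp add: power2_eq_square algebra_simps) linarith
  also have "\<dots> \<longleftrightarrow> 2 * s\<^sup>2 - s \<le> 2 * (int p + int k)"
    by (rule of_int_le_iff)
  finally show ?thesis
    by (simp add: s_def)
qed

text \<open>\<open>twice_edges\<close> is nonincreasing up to the floor of \<open>z_dagger\<close>
  and nondecreasing from its ceiling. As \<open>n + k = 2 * (p + k)\<close>,
  \<open>n \<le> 2 * k\<^sup>2 - 2 * k\<close> means that \<open>z_dagger\<close> is at most 0, and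
  then 0 is a minimizer.\<close>

lemma formula_minimizes_twice_edges:
  assumes "p \<ge> 1" "k \<ge> 1" "n = 2 * p + k"
  obtains z0 where "0 \<le> z0" "z0 \<le> int p"
    "(if int n > 2 * (int k)\<^sup>2 - 2 * int k
      then Min ((\<lambda>z. D n k z / 2) ` {\<lfloor>z_dagger n k\<rfloor>, \<lceil>z_dagger n k\<rceil>})
      else D n k 0 / 2) = of_int (twice_edges (int p) (int k) z0) / 2"
    "\<And>z. 0 \<le> z \<Longrightarrow> z \<le> int p \<Longrightarrow> twice_edges (int p) (int k) z0 \<le> twice_edges (int p) (int k) z"
proof (cases "int n > 2 * (int k)\<^sup>2 - 2 * int k")
  case True
  let ?T = "twice_edges (int p) (int k)"
  define x where "x = z_dagger n k"
  have le_iff: "x \<le> of_int z \<longleftrightarrow> 2 * (int p + int k) \<le> 2 * (int k + z)\<^sup>2 - (int k + z)"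
    if "z \<ge> 0" for z
    unfolding x_def assms(3) using z_dagger_le_iff assms(2) that by blast
  have x0: "x > 0"
    using le_iff[of 0] True assms(3) by simp
  \<comment> \<open>At \<open>z = p\<close>, where \<open>s = N \<ge> 2\<close>, the threshold is
    already reached, so the ceiling stays within \<open>p\<close>.\<close>
  have "2 * (int p + int k) \<le> (int p + int k) * (int p + int k)"
    using assms(1,2) by (intro mult_right_mono) auto
  then have "2 * (int p + int k) \<le> 2 * (int k + int p)\<^sup>2 - (int k + int p)"
    by (simp add: power2_eq_square distrib_left distrib_right mult.commute)
  then have xp: "x \<le> real p"
    using le_iff[of "int p"] by simp
  have fc: "0 \<le> \<lfloor>x\<rfloor>" "0 \<le> \<lceil>x\<rceil>" "\<lfloor>x\<rfloor> \<le> int p" "\<lceil>x\<rceil> \<le> int p"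
    using x0 xp by (simp_all add: ceiling_le_iff floor_le_iff)
  have lower: "min (?T \<lfloor>x\<rfloor>) (?T \<lceil>x\<rceil>) \<le> ?T z" if "0 \<le> z" "z \<le> int p" for z
  proof (cases "of_int z \<le> x")
    case True
    have "2 * (int p + int k) \<ge> 2 * (int k + \<lfloor>x\<rfloor>)\<^sup>2 - (int k + \<lfloor>x\<rfloor>)"
      using le_z_dagger_iff[OF assms(2) fc(1), of p] by (simp add: x_def assms(3))
    then have "?T \<lfloor>x\<rfloor> \<le> ?T z"
      using True that assms(2) by (intro twice_edges_decseq) (auto simp: le_floor_iff)
    then show ?thesis
      by simp
  next
    case False
    have "2 * (int p + int k) \<le> 2 * (int k + \<lceil>x\<rceil>)\<^sup>2 - (int k + \<lceil>x\<rceil>)"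
      using le_iff[of "\<lceil>x\<rceil>"] fc by simp
    then have "?T \<lceil>x\<rceil> \<le> ?T z"
      using False that fc assms(2) by (intro twice_edges_incseq) (auto simp: ceiling_le_iff)
    then show ?thesis
      by simp
  qed
  have D: "D n k z / 2 = of_int (?T z) / 2" if "z \<ge> 0" for z
    using D_eq_twice_edges[OF assms(2) that] assms(3) by simp
  have "Min ((\<lambda>z. D n k z / 2) ` {\<lfloor>x\<rfloor>, \<lceil>x\<rceil>}) = of_int (min (?T \<lfloor>x\<rfloor>) (?T \<lceil>x\<rceil>)) / 2"
    using D fc by (auto simp: min_def)
  then show thesis
    using that[of "\<lfloor>x\<rfloor>"] that[of "\<lceil>x\<rceil>"] fc lower True
    unfolding x_def[symmetric] by (cases "?T \<lfloor>x\<rfloor> \<le> ?T \<lceil>x\<rceil>") (simp_all add: min_def)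
next
  case False
  then have "2 * (int p + int k) \<le> 2 * (int k + 0)\<^sup>2 - (int k + 0)"
    using assms(3) by simp
  then show thesis
    using that[of 0] False assms D_eq_twice_edges[of k 0 p] twice_edges_incseq[of "int k" 0 "int p"]
    by simp
qed

section \<open>Joins of a clique with odd cliques\<close>

lemma card_clique_join:
  fixes f :: "'a \<Rightarrow> 'b"
  assumes fin: "finite V" and UV: "U \<subseteq> V"
  shows "card (clique_join V U f) = (card U choose 2) + card U * card (V - U)
    + (\<Sum>i\<in>f ` (V - U). card {x \<in> V - U. f x = i} choose 2)"
proof -
  let ?C = "\<lambda>i. {x \<in> V - U. f x = i}"
  let ?pairs = "\<lambda>A. {e. e \<subseteq> A \<and> card e = 2}"
  let ?inner = "?pairs U"
  let ?cross = "(\<lambda>(u, x). {u, x}) ` (U \<times> (V - U))"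
  let ?outer = "\<Union>i\<in>f ` (V - U). ?pairs (?C i)"
  have finU: "finite U"
    using fin UV finite_subset by blast
  have finP: "finite (?pairs A)" if "finite A" for A :: "'a set"
    using that by simp
  have "clique_join V U f = ?inner \<union> ?cross \<union> ?outer"
  proof (intro equalityI subsetI)
    fix e assume "e \<in> clique_join V U f"
    then obtain x y where e: "e = {x, y}" "x \<in> V" "y \<in> V" "x \<noteq> y"
      and xy: "x \<in> U \<or> y \<in> U \<or> f x = f y"
      by (auto simp: clique_join_def)
    consider "x \<in> U" "y \<in> U" | "x \<in> U" "y \<notin> U" | "x \<notin> U" "y \<in> U" | "x \<notin> U" "y \<notin> U" "f x = f y"
      using xy by blast
    then show "e \<in> ?inner \<union> ?cross \<union> ?outer"
    proof cases
      case 3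
      then have "e = (\<lambda>(u, x). {u, x}) (y, x)" "(y, x) \<in> U \<times> (V - U)"
        using e by auto
      then show ?thesis
        by blast
    next
      case 4
      then have "e \<in> ?pairs (?C (f x))" "f x \<in> f ` (V - U)"
        using e by auto
      then show ?thesis
        by blast
    qed (use e in auto)
  next
    fix e assume "e \<in> ?inner \<union> ?cross \<union> ?outer"
    then show "e \<in> clique_join V U f"
      using UV by (auto simp: card_2_iff pair_in_clique_join_iff)
  qed
  moreover have "?inner \<inter> ?cross = {}" "(?inner \<union> ?cross) \<inter> ?outer = {}"
    by (auto simp: card_2_iff)
  moreover have "finite ?cross" "finite ?outer"
    using fin finU by auto
  ultimately have "card (clique_join V U f) = card ?inner + card ?cross + card ?outer"
    using finP[OF finU] by (metis (no_types, lifting) card_Un_disjoint finite_UnI)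
  moreover have "card ?inner = card U choose 2"
    using finU by (rule n_subsets)
  moreover have "card ?cross = card U * card (V - U)"
  proof -
    have "inj_on (\<lambda>(u, x). {u, x}) (U \<times> (V - U))"
      by (auto simp: inj_on_def doubleton_eq_iff)
    then show ?thesis
      by (simp add: card_image card_cartesian_product)
  qed
  moreover have "card ?outer = (\<Sum>i\<in>f ` (V - U). card (?C i) choose 2)"
  proof -
    have "card ?outer = (\<Sum>i\<in>f ` (V - U). card (?pairs (?C i)))"
    proof (intro card_UN_disjoint ballI impI)
      fix i j :: 'b
      assume ij: "i \<noteq> j"
      show "?pairs (?C i) \<inter> ?pairs (?C j) = {}"
      proof (rule equals0I)
        fix e assume "e \<in> ?pairs (?C i) \<inter> ?pairs (?C j)"
        then have e: "e \<subseteq> ?C i" "e \<subseteq> ?C j" "e \<noteq> {}"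
          by auto
        then show False
          using ij by blast
      qed
    next
      show "finite (?pairs (?C i))" for i
        using fin by (intro finP) simp
    qed (use fin in simp)
    also have "\<dots> = (\<Sum>i\<in>f ` (V - U). card (?C i) choose 2)"
      using fin by (intro sum.cong refl n_subsets) simp
    finally show ?thesis .
  qed
  ultimately show ?thesis
    by simp
qed

lemma twice_choose_two: "2 * int (m choose 2) = int m * (int m - 1)"
proof (cases m)
  case (Suc j)
  have "even (m * (m - 1))"
    by auto
  then have "2 * (m choose 2) = m * (m - 1)"
    unfolding choose_two by (rule dvd_mult_div_cancel)
  then have "2 * int (m choose 2) = int m * int (m - 1)"
    by (metis of_nat_mult of_nat_numeral)
  moreover have "int (m - 1) = int m - 1"
    using Suc by simp
  ultimately show ?thesis
    by (simp only:)
qed simp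

section \<open>Counting vertices and edges of a join with odd cliques\<close>

text \<open>Instantiated twice: by an arbitrary saturated graph for the lower bound and by the
  balanced construction for the upper bound.\<close>

locale odd_clique_join =
  fixes V U :: "'a set" and f :: "'a \<Rightarrow> 'b" and p k :: nat
  assumes finite_V: "finite V"
    and U_subset: "U \<subseteq> V"
    and card_V: "card V = 2 * p + k"
    and card_classes: "card (f ` (V - U)) = card U + k"
    and odd_class: "\<And>i. i \<in> f ` (V - U) \<Longrightarrow> odd (card {x \<in> V - U. f x = i})"
begin

abbreviation "E \<equiv> clique_join V U f"
abbreviation "I \<equiv> f ` (V - U)"
abbreviation "C i \<equiv> {x \<in> V - U. f x = i}"

text \<open>The \<open>c\<close> of a class with \<open>2 * c - 1\<close> vertices.\<close>

definition half :: "'b \<Rightarrow> nat" where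
  "half i = (card (C i) + 1) div 2"

lemma card_class: "i \<in> I \<Longrightarrow> card (C i) + 1 = 2 * half i"
  using odd_class[of i] by (simp add: half_def)

lemma half_pos: "i \<in> I \<Longrightarrow> half i \<ge> 1"
  using card_class[of i] by linarith

text \<open>With \<open>z = card U\<close>, the \<open>2 * p + k - z\<close> vertices outside
  \<open>U\<close> and the \<open>k + z\<close> classes add up to
  \<open>2 * (p + k)\<close>.\<close>

lemma sum_half: "(\<Sum>i\<in>I. half i) = p + k"
proof -
  have "V - U = (\<Union>i\<in>I. C i)"
    by auto
  moreover have "card (\<Union>i\<in>I. C i) = (\<Sum>i\<in>I. card (C i))"
    using finite_V by (intro card_UN_disjoint) auto
  ultimately have "card (V - U) + card I = (\<Sum>i\<in>I. card (C i) + 1)"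
    by (simp only: sum.distrib card_eq_sum)
  also have "\<dots> = 2 * (\<Sum>i\<in>I. half i)"
    unfolding sum_distrib_left by (intro sum.cong refl card_class)
  finally have "card (V - U) + card I = 2 * (\<Sum>i\<in>I. half i)" .
  moreover have "card (V - U) + card U = card V"
    using finite_V U_subset by (metis card_Diff_subset card_mono finite_subset le_add_diff_inverse2)
  ultimately show ?thesis
    using card_V card_classes by linarith
qed

lemma card_U_le: "card U \<le> p"
proof -
  have "card I * 1 \<le> (\<Sum>i\<in>I. half i)"
    using half_pos sum_bounded_below[of I 1 half] by simp
  then show ?thesis
    using sum_half card_classes by simp
qed

text \<open>A class contributes \<open>(2 * c - 1) * (2 * c - 2)\<close>. Both the sum of the
  \<open>c\<close> and the number of classes are fixed, so for given \<open>card U\<close> only the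
  sum of squares varies.\<close>

lemma twice_card_edges:
  "2 * int (card E) = - (int (card U))\<^sup>2 + (2 * (2 * int p + int k) + 1) * int (card U)
     + 4 * (\<Sum>i\<in>I. (int (half i))\<^sup>2) - 3 * (2 * int p + int k) - int k"
proof -
  define z where "z = int (card U)"
  have c: "int (card (V - U)) = 2 * int p + int k - z"
    using finite_V U_subset card_V card_mono[OF finite_V U_subset]
    by (simp add: card_Diff_subset finite_subset z_def)
  have "2 * int (card (C i) choose 2) = 4 * (int (half i))\<^sup>2 - 6 * int (half i) + 2" if "i \<in> I" for i
  proof -
    have "int (card (C i)) = 2 * int (half i) - 1"
      using card_class[OF that] by linarith
    then show ?thesis
      unfolding twice_choose_two by (simp only:) (simp add: power2_eq_square algebra_simps)
  qed
  then have "2 * int (\<Sum>i\<in>I. card (C i) choose 2)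
      = (\<Sum>i\<in>I. 4 * (int (half i))\<^sup>2 - 6 * int (half i) + 2)"
    unfolding of_nat_sum sum_distrib_left by (intro sum.cong refl)
  also have "\<dots> = 4 * (\<Sum>i\<in>I. (int (half i))\<^sup>2) - 6 * int (\<Sum>i\<in>I. half i) + 2 * int (card I)"
    by (simp add: sum.distrib sum_subtractf sum_distrib_left)
  finally have s: "2 * int (\<Sum>i\<in>I. card (C i) choose 2)
      = 4 * (\<Sum>i\<in>I. (int (half i))\<^sup>2) - 6 * (int p + int k) + 2 * (z + int k)"
    unfolding sum_half card_classes by (simp add: z_def)
  have "2 * int (card E) = 2 * int (card U choose 2) + 2 * (int (card U) * int (card (V - U)))
      + 2 * int (\<Sum>i\<in>I. card (C i) choose 2)"
    unfolding card_clique_join[OF finite_V U_subset] of_nat_add of_nat_mult by simp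
  then show ?thesis
    unfolding twice_choose_two s c z_def[symmetric] by (simp add: power2_eq_square algebra_simps)
qed

lemma simple_graph: "simple_graph V E"
  using finite_V by (auto simp: simple_graph_def clique_join_def)

section \<open>Saturation of the joins\<close>

text \<open>Each odd class has a vertex that is missed or matched into \<open>U\<close>. Hence there
  are at most \<open>card W + card U\<close> classes, fewer than \<open>k + card U\<close>.\<close>

lemma no_matching: "\<not> has_matching E (p + 1)"
proof
  assume "has_matching E (p + 1)"
  then obtain M where M: "M \<subseteq> E" "matching M" "card M = p + 1"
    using simple_graph has_matching_iff[of E] by (auto simp: simple_graph_def)
  have MV: "\<Union>M \<subseteq> V"
    using M(1) simple_graph unfolding simple_graph_def by (intro Union_least) blast
  define W where "W = V - \<Union>M"
  have "card W = 2 * p + k - 2 * (p + 1)"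
    unfolding W_def card_Diff_subset[OF finite_subset[OF MV finite_V] MV]
    by (simp only: card_V card_Union_matching[OF M(2)] M(3))
  \<comment> \<open>This gives \<open>k \<ge> 2\<close>, so the subtraction above is not truncated
    and \<open>card W = k - 2\<close>.\<close>
  moreover have "card (\<Union>M) \<le> card V"
    using MV finite_V by (rule card_mono[rotated])
  ultimately have W: "card W < k"
    using card_V card_Union_matching[OF M(2)] M(3) by simp
  \<comment> \<open>\<open>R i w\<close> assigns to class \<open>i\<close> either a missed vertex of
    that class or a vertex of \<open>U\<close> matched into it; \<open>w\<close> determines
    \<open>i\<close>.\<close>
  define R where "R i w \<longleftrightarrow> w \<in> W - U \<and> f w = i \<or> w \<in> U \<and> (\<exists>x\<in>C i. {w, x} \<in> M)" for i w
  have ex: "\<exists>w. R i w" if i: "i \<in> I" for i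
  proof (rule ccontr)
    assume no: "\<nexists>w. R i w"
    have "even (card (C i))"
    proof (rule even_card_if_matched_within[OF M(2)])
      show "finite (C i)"
        using finite_V by simp
      fix x assume x: "x \<in> C i"
      then have xi: "x \<in> V" "x \<notin> U" "f x = i"
        by simp_all
      then have "x \<notin> W"
        using no by (auto simp: R_def)
      then have "x \<in> \<Union>M"
        using xi(1) unfolding W_def by (metis DiffI)
      then obtain y where y: "{x, y} \<in> M"
        using matching_partner[OF M(2)] by metis
      have "y \<notin> U"
      proof
        assume "y \<in> U"
        moreover have "{y, x} \<in> M"
          using y by (simp add: insert_commute)
        ultimately have "R i y"
          unfolding R_def using x by blast
        then show False
          using no by blast
      qed
      moreover have "{x, y} \<in> E"
        using y M(1) by blast
      ultimately show "\<exists>y\<in>C i. {x, y} \<in> M"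
        using x y by (auto simp: pair_in_clique_join_iff)
    qed
    then show False
      using odd_class i by simp
  qed
  define h where "h i = (SOME w. R i w)" for i
  have h: "R i (h i)" if "i \<in> I" for i
    unfolding h_def using ex[OF that] by (rule someI_ex)
  have R_unique: "i = j" if "R i w" "R j w" for i j w
  proof (cases "w \<in> U")
    case True
    then have "\<exists>x. f x = i \<and> {w, x} \<in> M" "\<exists>y. f y = j \<and> {w, y} \<in> M"
      using that by (auto simp: R_def)
    then show ?thesis
      using matching_partner_unique[OF M(2)] by metis
  next
    case False
    then show ?thesis
      using that by (simp add: R_def)
  qed
  have "inj_on h I"
    using h R_unique by (metis inj_onI)
  moreover have "h ` I \<subseteq> W \<union> U"
    using h by (auto simp: R_def)
  moreover have "finite (W \<union> U)"
    using finite_V U_subset finite_subset by (auto simp: W_def)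
  ultimately have "card I \<le> card (W \<union> U)"
    by (rule card_inj_on_le)
  then show False
    using card_Un_le[of W U] W card_classes by simp
qed

text \<open>Take one representative per class, \<open>x\<close> and \<open>y\<close> among them.
  Pair up the rest of each class, match \<open>U\<close> to other representatives and add
  \<open>{x, y}\<close>; just \<open>k - 2\<close> representatives stay missed.\<close>

lemma has_matching_insert:
  assumes k: "k \<ge> 2" and xy: "x \<in> V" "y \<in> V" "x \<noteq> y" "{x, y} \<notin> E"
  shows "has_matching (insert {x, y} E) (p + 1)"
proof -
  let ?F = "insert {x, y} E"
  have nxy: "x \<notin> U" "y \<notin> U" "f x \<noteq> f y"
    using xy by (auto simp: pair_in_clique_join_iff)
  define r where "r i = (if i = f x then x else if i = f y then y else SOME w. w \<in> C i)" for i
  have r: "r i \<in> C i" if "i \<in> I" for i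
  proof -
    have "\<exists>w. w \<in> C i"
      using that by auto
    then have "(SOME w. w \<in> C i) \<in> C i"
      by (rule someI_ex)
    then show ?thesis
      using nxy xy by (simp add: r_def)
  qed
  then have inj_r: "inj_on r I"
    by (metis (mono_tags, lifting) inj_onI mem_Collect_eq)
  let ?I' = "I - {f x, f y}"
  have fxy: "{f x, f y} \<subseteq> I"
    using nxy xy by auto
  have finI: "finite I"
    using finite_V by simp
  \<comment> \<open>As \<open>k \<ge> 2\<close>, the classes other than those of \<open>x\<close>
    and \<open>y\<close> suffice to provide distinct partners for \<open>U\<close>.\<close>
  have "card ?I' = card U + k - 2"
    using fxy finI nxy by (simp add: card_Diff_subset card_classes)
  then have "card U \<le> card ?I'"
    using k by simp
  then obtain J where J: "J \<subseteq> ?I'" "card J = card U"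
    by (meson obtain_subset_with_card_n)
  have finU: "finite U"
    using U_subset finite_V finite_subset by blast
  obtain g where g: "bij_betw g U J"
    using J finI finU finite_same_card_bij[of U J] by (metis finite_Diff finite_subset)
  have gI: "g u \<in> ?I'" if "u \<in> U" for u
    using g J(1) that by (auto simp: bij_betw_def)
  have rg: "r (g u) \<in> V - U" "r (g u) \<noteq> x" "r (g u) \<noteq> y" "f (r (g u)) = g u" if "u \<in> U" for u
    using r[of "g u"] gI[OF that] by auto
  \<comment> \<open>\<open>X\<close> is covered by edges inside the classes, \<open>Y\<close> by the
    edges between \<open>U\<close> and the chosen representatives.\<close>
  define X where "X = (\<Union>i\<in>I. C i - {r i})"
  define Y where "Y = (\<Union>u\<in>U. {u, r (g u)})"
  have single: "matching {{a, b}}" if "a \<noteq> b" for a b :: 'a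
    using that by (simp add: matching_def)
  have "\<exists>M\<subseteq>?F. matching M \<and> \<Union>M = X"
    unfolding X_def
  proof (rule matching_covering_UN[OF finI])
    show "disjoint_family_on (\<lambda>i. C i - {r i}) I"
      by (auto simp: disjoint_family_on_def)
    fix i assume i: "i \<in> I"
    have "card (C i) = Suc (card (C i - {r i}))"
      using finite_V r[OF i] by (intro card.remove) auto
    then have "even (card (C i - {r i}))"
      using odd_class[OF i] by simp
    then obtain M where M: "matching M" "\<Union>M = C i - {r i}"
      using ex_matching_covering[of "C i - {r i}"] finite_V by auto
    have "M \<subseteq> ?F"
    proof
      fix e assume e: "e \<in> M"
      then have "card e = 2"
        using M(1) by (simp add: matching_def)
      moreover have "e \<subseteq> C i"
        using e M(2) by blast
      ultimately show "e \<in> ?F"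
        by (auto simp: card_2_iff pair_in_clique_join_iff)
    qed
    then show "\<exists>M\<subseteq>?F. matching M \<and> \<Union>M = C i - {r i}"
      using M by (intro exI[of _ M] conjI)
  qed
  then obtain M1 where M1: "M1 \<subseteq> ?F" "matching M1" "\<Union>M1 = X"
    by metis
  have "\<exists>M\<subseteq>?F. matching M \<and> \<Union>M = Y"
    unfolding Y_def
  proof (rule matching_covering_UN[OF finU])
    have "u = v" if "u \<in> U" "v \<in> U" "r (g u) = r (g v)" for u v
    proof -
      have "g u = g v"
        using that rg(4) by metis
      then show ?thesis
        using g that by (auto simp: bij_betw_def inj_on_def)
    qed
    then show "disjoint_family_on (\<lambda>u. {u, r (g u)}) U"
      using rg(1) unfolding disjoint_family_on_def by blast
    fix u assume u: "u \<in> U"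
    then have "{u, r (g u)} \<in> ?F" "u \<noteq> r (g u)"
      using rg(1)[OF u] U_subset by (auto simp: pair_in_clique_join_iff)
    then show "\<exists>M\<subseteq>?F. matching M \<and> \<Union>M = {u, r (g u)}"
      using single by (intro exI[of _ "{{u, r (g u)}}"]) simp
  qed
  then obtain M2 where M2: "M2 \<subseteq> ?F" "matching M2" "\<Union>M2 = Y"
    by metis
  have rI: "r ` I \<subseteq> V - U"
    using r by blast
  have "r i \<notin> X" if "i \<in> I" for i
    using r[OF that] by (auto simp: X_def)
  then have rX: "r ` I \<inter> X = {}"
    by blast
  have XV: "X \<subseteq> V - U"
    by (auto simp: X_def)
  have rxy: "r ` {f x, f y} = {x, y}"
    using nxy by (auto simp: r_def)
  have JI: "J \<subseteq> I"
    using J(1) by blast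
  have "r ` J \<inter> r ` {f x, f y} = r ` (J \<inter> {f x, f y})"
    using inj_on_image_Int[OF inj_r JI fxy] by simp
  then have rJ: "r ` J \<inter> {x, y} = {}"
    using J(1) by (auto simp only: rxy)
  have "Y = U \<union> r ` g ` U"
    by (auto simp: Y_def)
  then have Y: "Y = U \<union> r ` J"
    using g by (simp add: bij_betw_def)
  have xyI: "{x, y} \<subseteq> r ` I" "r ` J \<subseteq> r ` I"
    using image_mono[OF fxy, of r] image_mono[OF JI, of r] unfolding rxy by simp_all
  define S T where "S = r ` I" and "T = r ` J"
  note ST = S_def[symmetric] T_def[symmetric]
  have XY: "X \<inter> Y = {}" "x \<notin> X \<union> Y" "y \<notin> X \<union> Y"
    using rX xyI rJ rI XV unfolding Y ST by blast+
  have m12: "matching (M1 \<union> M2)"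
    using matching_Un[OF M1(2) M2(2)] XY(1) by (simp only: M1(3) M2(3))
  have U12: "\<Union>(M1 \<union> M2) = X \<union> Y"
    by (simp only: Union_Un_distrib M1(3) M2(3))
  define M where "M = insert {x, y} (M1 \<union> M2)"
  have M: "matching M" "M \<subseteq> ?F" "\<Union>M = X \<union> Y \<union> {x, y}"
    unfolding M_def using matching_insert(1)[OF m12 xy(3)] XY(2,3) M1(1) M2(1)
    by (simp_all only: U12 Union_insert Un_commute insert_subset Un_subset_iff insertI1 simp_thms)
  have "V - \<Union>M = r ` (?I' - J)"
  proof -
    have "V - X = U \<union> r ` I"
    proof (intro equalityI subsetI)
      fix v assume v: "v \<in> V - X"
      show "v \<in> U \<union> r ` I"
      proof (cases "v \<in> U")
        case False
        then have "v = r (f v)" "f v \<in> I"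
          using v by (auto simp: X_def)
        then show ?thesis
          by blast
      qed simp
    next
      fix v assume "v \<in> U \<union> r ` I"
      then show "v \<in> V - X"
        using rX XV U_subset rI unfolding ST by blast
    qed
    then have "V - \<Union>M = r ` I - r ` {f x, f y} - r ` J"
      using rI unfolding M(3) Y rxy ST by blast
    also have "\<dots> = r ` ?I' - r ` J"
      using inj_on_image_set_diff[OF inj_r _ fxy, of I] by simp
    also have "\<dots> = r ` (?I' - J)"
      using inj_on_image_set_diff[OF inj_r _ JI, of ?I'] by blast
    finally show ?thesis .
  qed
  moreover have "card (?I' - J) = k - 2"
    using J \<open>card ?I' = card U + k - 2\<close> finI k
    by (simp add: card_Diff_subset finite_subset)
  moreover have "inj_on r (?I' - J)"
    using inj_r by (rule inj_on_subset) auto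
  ultimately have "card (V - \<Union>M) = k - 2"
    by (metis card_image)
  moreover have MV: "\<Union>M \<subseteq> V"
    using xy(1,2) XV U_subset rI xyI(2) unfolding M(3) Y ST by blast
  ultimately have "card V - card (\<Union>M) = k - 2" "card (\<Union>M) \<le> card V"
    using card_Diff_subset[OF finite_subset[OF MV finite_V] MV] card_mono[OF finite_V MV] by simp_all
  then have "card M = p + 1"
    using card_Union_matching[OF M(1)] card_V k by simp
  moreover have "\<forall>e\<in>?F. card e = 2"
    using simple_graph xy(3) by (auto simp: simple_graph_def)
  ultimately show ?thesis
    using has_matching_iff[of ?F] M(1,2) by metis
qed

lemma saturated: "k \<ge> 2 \<Longrightarrow> matching_saturated (p + 1) V E"
  using no_matching has_matching_insert by (simp add: matching_saturated_def)

end

section \<open>Lower bound, extremal graphs and conclusion\<close>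

context saturated_graph
begin

text \<open>Take \<open>z = card universal\<close>: the exact edge count has a sum of squares in
  place of \<open>min_sq\<close>, which is a lower bound for it.\<close>

lemma twice_edges_le:
  obtains z where "z \<le> p" "twice_edges (int p) (int k) (int z) \<le> 2 * int (card E)"
proof -
  interpret J: odd_clique_join V universal clique p k
  proof
    show "universal \<subseteq> V"
      by (auto simp: universal_def)
    fix C assume "C \<in> clique ` (V - universal)"
    then obtain x where x: "x \<in> V - universal" "C = clique x"
      by blast
    then have "{y \<in> V - universal. clique y = C} = C"
      using in_clique_iff[OF x(1)] by blast
    then show "odd (card {y \<in> V - universal. clique y = C})"
      using odd_clique[OF x(1)] x(2) by simp
  qed (use finite_V card_V card_cliques in simp_all)
  have "(\<Sum>i\<in>J.I. int (J.half i)) = int p + int k"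
    using J.sum_half by (metis of_nat_add of_nat_sum)
  moreover have "int (card J.I) = int k + int (card universal)"
    unfolding card_cliques by simp
  ultimately have "min_sq (int p + int k) (int k + int (card universal)) \<le> (\<Sum>i\<in>J.I. (int (J.half i))\<^sup>2)"
    using min_sq_le_sum_squares[of "\<lambda>i. int (J.half i)" J.I] by (simp only:)
  moreover have "card E = card J.E"
    by (rule arg_cong[OF eq_clique_join])
  ultimately have "twice_edges (int p) (int k) (int (card universal)) \<le> 2 * int (card E)"
    using J.twice_card_edges unfolding twice_edges_def by linarith
  then show thesis
    using that J.card_U_le by blast
qed

end

lemma ex_fibres_of_size:
  assumes "finite A" "card A = (\<Sum>i<s. d i)"
  shows "\<exists>f. (\<forall>x\<in>A. f x < (s::nat)) \<and> (\<forall>i<s. card {x \<in> A. f x = i} = d i)"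
  using assms
proof (induction s arbitrary: A)
  case (Suc s)
  then have "d s \<le> card A"
    by simp
  then obtain B where B: "B \<subseteq> A" "card B = d s"
    by (meson obtain_subset_with_card_n)
  then have "card (A - B) = (\<Sum>i<s. d i)"
    using Suc.prems by (simp add: card_Diff_subset finite_subset)
  then obtain f where f: "\<forall>x\<in>A - B. f x < s" "\<forall>i<s. card {x \<in> A - B. f x = i} = d i"
    using Suc.IH[of "A - B"] Suc.prems by auto
  let ?f = "\<lambda>x. if x \<in> B then s else f x"
  have "{x \<in> A. ?f x = i} = {x \<in> A - B. f x = i}" if "i < s" for i
    using that by auto
  moreover have "{x \<in> A. ?f x = s} = B"
    using B f(1) by auto
  ultimately have "\<forall>i<Suc s. card {x \<in> A. ?f x = i} = d i"
    using f(2) B(2) by (simp add: less_Suc_eq)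
  moreover have "\<forall>x\<in>A. ?f x < Suc s"
    using f(1) by (auto simp: less_Suc_eq)
  ultimately show ?case
    by (intro exI[of _ ?f] conjI)
qed simp

text \<open>The classes get the odd sizes \<open>2 * c i - 1\<close> for the balanced
  \<open>c\<close> of \<open>min_sq_attained\<close>.\<close>

lemma ex_saturated_graph:
  assumes "k \<ge> 2" "z \<le> p"
  obtains V :: "nat set" and E where "simple_graph V E" "card V = 2 * p + k"
    "matching_saturated (p + 1) V E" "2 * int (card E) = twice_edges (int p) (int k) (int z)"
proof -
  define s where "s = k + z"
  have s: "s > 0"
    using assms by (simp add: s_def)
  obtain c :: "nat \<Rightarrow> nat" where c: "(\<Sum>i<s. c i) = p + k"
    "(\<Sum>i<s. int (c i) ^ 2) = min_sq (p + k) s" and c_ge: "\<And>i. (p + k) div s \<le> c i"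
    using min_sq_attained[OF s, of "p + k"] by blast
  \<comment> \<open>\<open>z \<le> p\<close> means \<open>s \<le> p + k\<close>. So every
    \<open>c i\<close> is positive, no class is empty, and \<open>2 * c i - 1\<close> is not
    truncated.\<close>
  have "1 \<le> (p + k) div s"
    using s assms by (simp add: s_def Suc_le_eq div_greater_zero_iff)
  then have c1: "1 \<le> c i" for i
    using c_ge[of i] by linarith
  let ?d = "\<lambda>i. 2 * c i - 1"
  let ?V = "{..<2 * p + k}"
  let ?U = "{..<z}"
  have "(\<Sum>i<s. ?d i) + s = (\<Sum>i<s. ?d i + 1)"
    by (simp only: sum.distrib) simp
  also have "\<dots> = (\<Sum>i<s. 2 * c i)"
    by (intro sum.cong refl) (use c1 in \<open>simp add: le_simps\<close>)
  also have "\<dots> = 2 * (p + k)"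
    using c(1) by (simp only: sum_distrib_left[symmetric])
  finally have "(\<Sum>i<s. ?d i) + s = 2 * (p + k)" .
  then have "card (?V - ?U) = (\<Sum>i<s. ?d i)"
    using assms by (simp add: card_Diff_subset s_def)
  then obtain f where f: "\<forall>x\<in>?V - ?U. f x < s" "\<forall>i<s. card {x \<in> ?V - ?U. f x = i} = ?d i"
    using ex_fibres_of_size[of "?V - ?U" ?d s] by blast
  have I: "f ` (?V - ?U) = {..<s}"
  proof (intro equalityI subsetI)
    fix i assume "i \<in> {..<s}"
    then have "card {x \<in> ?V - ?U. f x = i} \<noteq> 0"
      using f(2) c1[of i] by simp
    then have "{x \<in> ?V - ?U. f x = i} \<noteq> {}"
      by (metis card.empty)
    then show "i \<in> f ` (?V - ?U)"
      by blast
  qed (use f(1) in auto)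
  interpret J: odd_clique_join ?V ?U f p k
  proof
    fix i assume "i \<in> f ` (?V - ?U)"
    then have "i < s"
      unfolding I by simp
    then show "odd (card {x \<in> ?V - ?U. f x = i})"
      using f(2) c1[of i] by simp
  qed (use assms I in \<open>simp_all add: s_def\<close>)
  have "J.half i = c i" if "i < s" for i
    using f(2) that c1[of i] by (simp add: J.half_def)
  then have "(\<Sum>i\<in>J.I. (int (J.half i))\<^sup>2) = min_sq (p + k) s"
    unfolding I c(2)[symmetric] by simp
  then have "2 * int (card J.E) = twice_edges (int p) (int k) (int z)"
    unfolding J.twice_card_edges twice_edges_def by (simp add: s_def)
  then show thesis
    using that J.simple_graph J.saturated[OF assms(1)] by simp
qed

theorem theorem4:
  fixes n p k :: nat
  assumes "n > 0" and "p > 0" and "n > 2 * p"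
    and large_enough: "n \<ge> 2 * (p + 1)"
    and k: "k = n - 2 * p"
  shows "real (sat_matching n (p + 1)) =
    (if int n > 2 * (int k)\<^sup>2 - 2 * int k
     then Min ((\<lambda>z. D n k z / 2) ` {\<lfloor>z_dagger n k\<rfloor>, \<lceil>z_dagger n k\<rceil>})
     else D n k 0 / 2)"
proof -
  have p1: "p \<ge> 1" and k1: "k \<ge> 1" and k2: "k \<ge> 2" and n: "n = 2 * p + k"
    using assms(2) large_enough k by auto
  let ?T = "twice_edges (int p) (int k)"
  obtain z0 where z0: "0 \<le> z0" "z0 \<le> int p"
    and eq: "(if int n > 2 * (int k)\<^sup>2 - 2 * int k
      then Min ((\<lambda>z. D n k z / 2) ` {\<lfloor>z_dagger n k\<rfloor>, \<lceil>z_dagger n k\<rceil>})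
      else D n k 0 / 2) = of_int (?T z0) / 2"
    and le: "\<And>z. 0 \<le> z \<Longrightarrow> z \<le> int p \<Longrightarrow> ?T z0 \<le> ?T z"
    by (rule formula_minimizes_twice_edges[OF p1 k1 n]) (rule that)
  obtain V :: "nat set" and E where VE: "simple_graph V E" "card V = n"
    "matching_saturated (p + 1) V E" "2 * int (card E) = ?T z0"
  proof (rule ex_saturated_graph[OF k2])
    show "nat z0 \<le> p"
      using z0 by simp
  qed (use z0 n that in simp)
  have "sat_matching n (p + 1) = card E"
    unfolding sat_matching_def
  proof (rule Least_equality)
    show "\<exists>(V' :: nat set) E'. simple_graph V' E' \<and> card V' = n \<and> matching_saturated (p + 1) V' E'
        \<and> card E' = card E"
      using VE by blast
    fix m
    assume "\<exists>(V' :: nat set) E'. simple_graph V' E' \<and> card V' = n \<and> matching_saturated (p + 1) V' E'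
        \<and> card E' = m"
    \<comment> \<open>Every competitor has at least half of \<open>?T z\<close> edges for some
      \<open>z \<le> p\<close>, and \<open>z0\<close> minimizes \<open>?T\<close> on this
      range.\<close>
    then obtain V' :: "nat set" and E' where m: "saturated_graph V' E' p k" "card E' = m"
      using k2 n by (auto simp: saturated_graph_def)
    obtain z where "z \<le> p" "?T (int z) \<le> 2 * int m"
      using saturated_graph.twice_edges_le[OF m(1)] m(2) by metis
    then show "card E \<le> m"
      using le[of "int z"] VE(4) by linarith
  qed
  then show ?thesis
    unfolding eq VE(4)[symmetric] by simp
qed

end
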